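(* As $m\to\infty$, $\sigma(\Delta_m)\to\{0,1\}$ in the Hausdorff metric. Moreover, $\lim_{m\to\infty}\kappa_m=\delta_1$ in the weak topology of measures, where $\delta_1$ is the unit point mass at $1$ and $$\kappa_m=\lim_{n\to\infty}\frac{1}{\dim_n}\sum_{z\in\sigma(\Delta_m)}\mathrm{mult}_n(z)\,\delta_z .$$
   Context: Graphs. For an integer $m\ge 3$, the graphs $V_{m,n}$, $n\ge 0$, each with a distinguished family of cells (vertex sets of size $m$ spanning complete subgraphs), are defined recursively. $V_{m,0}$ is the complete graph on $m$ vertices, with one cell, the whole vertex set. $V_{m,n+1}$ is obtained from $V_{m,n}$ by replacing every cell $\{x_1,\dots,x_m\}$ as follows: remove the edges of the cell, add one new vertex $c$, and for each $i=1,\dots,m$ add $m-2$ further new vertices and make $x_i$, $c$ and these $m-2$ vertices into a complete graph on $m$ vertices; these $m$ complete graphs (which share only $c$) are the new cells. All new vertices are distinct for distinct cells. The edges of $V_{m,n}$ are exactly those joining two vertices of a common cell. $\dim_n$ is the number of vertices of $V_{m,n}$. Laplacians. $M_{m,n}$ is the matrix, indexed by the vertices of $V_{m,n}$, of the probabilistic Laplacian $\Delta_{m,n}f(x)=f(x)-\frac{1}{\deg(x)}\sum_{y\sim x}f(y)$: diagonal entries are $1$, the $(x,y)$ entry is $-1/\deg(x)$ if $x$ and $y$ are adjacent, and all other entries are $0$. $\mathrm{mult}_n(z)$ is the multiplicity of $z$ as an eigenvalue of $M_{m,n}$ ($0$ if $z$ is not an eigenvalue). Limit. $\Delta_m$ denotes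 the limiting Laplacian of the matrices $M_{m,n}$ as $n\to\infty$, and $\sigma(\Delta_m)$ is the limiting set of eigenvalues, $\sigma(\Delta_m)=\bigcup_{n\ge 0}\sigma(M_{m,n})$. The measures $\kappa_m$ are measures on the complex plane ($\delta_z$ is the unit point mass at $z$), and the limit over $n$ defining $\kappa_m$ is a weak limit. Hausdorff distance is taken between bounded subsets of $\mathbb{C}$ (it is unchanged by passing to closures). *)

theory Defs
  imports
    "HOL-Probability.Probability"
    "Jordan_Normal_Form.Spectral_Radius"
begin

(* The vertices of V_{m,n} are the numbers 0, ..., vertex_count m n - 1, and a cell is represented
   by a list without repetitions of its m vertices. The order within a cell and the order of the
   cells only determine how new vertices are numbered. *)

(* The m new cells replacing the cell xs. The numbers s, ..., s + m * (m - 2) are the new vertices: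
   s is the common new vertex c, and those with offset 1 + i * (m - 2) up to
   (i + 1) * (m - 2) are the m - 2 further vertices belonging to the vertex xs ! i. *)
definition subdivide_cell :: "nat \<Rightarrow> nat \<Rightarrow> nat list \<Rightarrow> nat list list" where
  "subdivide_cell m s xs =
     map (\<lambda>i. xs ! i # s # [s + 1 + i * (m - 2) ..< s + 1 + (i + 1) * (m - 2)]) [0..<m]"

fun vertex_count :: "nat \<Rightarrow> nat \<Rightarrow> nat"
  and cells :: "nat \<Rightarrow> nat \<Rightarrow> nat list list" where
  "vertex_count m 0 = m"
| "cells m 0 = [[0..<m]]"
| "vertex_count m (Suc n) = vertex_count m n + length (cells m n) * (1 + m * (m - 2))"
| "cells m (Suc n) =
     concat (map (\<lambda>k. subdivide_cell m (vertex_count m n + k * (1 + m * (m - 2))) (cells m n ! k))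
       [0..<length (cells m n)])"

definition adjacent :: "nat \<Rightarrow> nat \<Rightarrow> nat \<Rightarrow> nat \<Rightarrow> bool" where
  "adjacent m n x y \<longleftrightarrow> x \<noteq> y \<and> (\<exists>C \<in> set (cells m n). x \<in> set C \<and> y \<in> set C)"

definition vertex_degree :: "nat \<Rightarrow> nat \<Rightarrow> nat \<Rightarrow> nat" where
  "vertex_degree m n x = card {y \<in> {..<vertex_count m n}. adjacent m n x y}"

definition laplacian :: "nat \<Rightarrow> nat \<Rightarrow> complex mat" where
  "laplacian m n = mat (vertex_count m n) (vertex_count m n)
     (\<lambda>(x, y). if x = y then 1
               else if adjacent m n x y then - 1 / of_nat (vertex_degree m n x) else 0)"

definition eigenvalue_mult :: "nat \<Rightarrow> nat \<Rightarrow> complex \<Rightarrow> nat" where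
  "eigenvalue_mult m n z = Polynomial.order z (char_poly (laplacian m n))"

definition limit_spectrum :: "nat \<Rightarrow> complex set" where
  "limit_spectrum m = (\<Union>n. spectrum (laplacian m n))"

(* (1 / dim_n) * (sum over z in limit_spectrum m of mult_n(z) * delta_z), as a Borel measure *)
definition eigenvalue_measure :: "nat \<Rightarrow> nat \<Rightarrow> complex measure" where
  "eigenvalue_measure m n =
     distr (point_measure (limit_spectrum m)
              (\<lambda>z. ennreal (real (eigenvalue_mult m n z) / real (vertex_count m n))))
           borel (\<lambda>z. z)"

(* Infinite if exactly one of the two sets is empty, or exactly one of them is unbounded. *)
definition hausdorff_distance :: "'a::metric_space set \<Rightarrow> 'a set \<Rightarrow> ennreal" where
  "hausdorff_distance S T =
     max (SUP x\<in>S. INF y\<in>T. ennreal (dist x y)) (SUP y\<in>T. INF x\<in>S. ennreal (dist x y))"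

definition finite_borel_measure :: "'a::topological_space measure \<Rightarrow> bool" where
  "finite_borel_measure M \<longleftrightarrow> sets M = sets borel \<and> finite_measure M"

definition weakly_converges :: "(nat \<Rightarrow> 'a::topological_space measure) \<Rightarrow> 'a measure \<Rightarrow> bool" where
  "weakly_converges M N \<longleftrightarrow>
     (\<forall>\<^sub>F n in sequentially. finite_borel_measure (M n)) \<and> finite_borel_measure N \<and>
     (\<forall>f :: 'a \<Rightarrow> real. continuous_on UNIV f \<longrightarrow> bounded (range f) \<longrightarrow>
        (\<lambda>n. integral\<^sup>L (M n) f) \<longlonglongrightarrow> integral\<^sup>L N f)"

end

theory Submission
  imports Defs "HOL-Real_Asymp.Real_Asymp"
begin

text \<open>Let R be the diagonal matrix of the numbers of cells containing the vertices and B the vertex-cell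
  incidence matrix. Two distinct vertices share at most one cell, so the Laplacian is an affine
  function of R^-1 B B^T, whose nonzero eigenvalues are those of the cell matrix G = B^T R^-1 B.
  The next cell matrix has the form (m - 2) + P + Q for two projections P, Q such that P Q P acts as
  G / m on the range of P. Hence an eigenvalue w of G produces the eigenvalues m - 1 + sqrt (w / m)
  and m - 1 - sqrt (w / m) (only the first one if w = m), and all the others equal m - 1. So all
  cell eigenvalues are within 1 of m - 1, which puts the Laplacian spectrum near 0 and 1. The same
  recursion makes averages over the cell eigenvalues converge to the law of this two-valued random
  step iterated a geometric number of times, and only the fraction 1 / (m - 1) of the Laplacian
  eigenvalues differs from m / (m - 1).\<close>

section \<open>Determinants\<close>

text \<open>Multiplicities are orders of roots of characteristic polynomials, and the Laplacian is
  not a symmetric matrix. The argument therefore compares characteristic polynomials by exchanging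
  \<open>X * Y\<close> and \<open>Y * X\<close> under the determinant, which transports algebraic
  multiplicities without eigenvectors or diagonalizability. The price is a finite set of parameters
  at which a factor cannot be cancelled; equality of the multisets of roots survives it. Cells are
  preferred to vertices because subdivision acts on them uniformly: each cell of the next level
  corresponds to a pair of an old cell and one of its vertices. The next cell matrix is thus
  described by the old incidences alone, whereas the vertices of the next level are of three
  different kinds. The existence of the weak limits is part of the claim. Each limit is written down
  as a concrete law, so that convergence becomes an explicit estimate and no compactness argument is
  involved.\<close>

lemma det_smult_one_minus_mult_commute:
  fixes X Y :: "complex mat"
  assumes X: "X \<in> carrier_mat a b" and Y: "Y \<in> carrier_mat b a"
  shows "s ^ b * det (s \<cdot>\<^sub>m 1\<^sub>m a - X * Y) = s ^ a * det (s \<cdot>\<^sub>m 1\<^sub>m b - Y * X)"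
proof -
  \<comment> \<open>Both determinants are Schur complements of this block matrix. The multiplier
    \<open>L'\<close> carries \<open>s\<close> in its lower corner, so nothing is divided by
    \<open>s\<close>.\<close>
  define M where "M = four_block_mat (s \<cdot>\<^sub>m 1\<^sub>m a) X Y (1\<^sub>m b)"
  have M: "M \<in> carrier_mat (a + b) (a + b)"
    unfolding M_def using X Y by auto
  define L where "L = four_block_mat (1\<^sub>m a) (0\<^sub>m a b) (- Y) (1\<^sub>m b)"
  define L' where "L' = four_block_mat (1\<^sub>m a) (0\<^sub>m a b) (- Y) (s \<cdot>\<^sub>m 1\<^sub>m b)"
  have L: "L \<in> carrier_mat (a + b) (a + b)" "L' \<in> carrier_mat (a + b) (a + b)"
    unfolding L_def L'_def using Y by auto
  have dL: "det L = 1" "det L' = s ^ b"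
    unfolding L_def L'_def using Y
    by (subst det_four_block_mat_upper_right_zero[where n=a and m=b]; auto)+
  have XY: "X * Y \<in> carrier_mat a a" "Y * X \<in> carrier_mat b b" using X Y by auto
  have M_L: "M * L = four_block_mat (s \<cdot>\<^sub>m 1\<^sub>m a - X * Y) X (0\<^sub>m b a) (1\<^sub>m b)"
    unfolding M_def L_def using X Y XY
    by (subst mult_four_block_mat[of _ a a _ b _ b _ _ a _ b])
       (auto intro!: arg_cong2[where f="\<lambda>A B. four_block_mat A X B (1\<^sub>m b)"]
          simp: minus_add_uminus_mat[of _ a a])
  have L_M: "L' * M = four_block_mat (s \<cdot>\<^sub>m 1\<^sub>m a) X (0\<^sub>m b a) (s \<cdot>\<^sub>m 1\<^sub>m b - Y * X)"
    unfolding M_def L'_def using X Y XY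
    by (subst mult_four_block_mat[of _ a a _ b _ b _ _ a _ b]) auto
  have "det M = det (s \<cdot>\<^sub>m 1\<^sub>m a - X * Y)"
    using det_mult[OF M L(1)] dL X XY unfolding M_L
    by (subst (asm) det_four_block_mat_lower_left_zero[where n=a and m=b]) (auto intro!: minus_carrier_mat)
  moreover have "s ^ b * det M = s ^ a * det (s \<cdot>\<^sub>m 1\<^sub>m b - Y * X)"
    using det_mult[OF L(2) M] dL X XY unfolding L_M
    by (subst (asm) det_four_block_mat_lower_left_zero[where n=a and m=b]) (auto intro!: minus_carrier_mat)
  ultimately show ?thesis by simp
qed

text \<open>With the projections P = \<open>U * U'\<close> and Q = \<open>V * W\<close>, the matrix
  K = (s - 1) + P inverts s - P up to the factor \<open>s * (s - 1)\<close>. Multiplying s - P - Q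
  by K leaves a scalar minus one product, and two exchanges of factors reduce the size from
  \<open>f\<close> to \<open>n\<close> and then to \<open>c\<close>. The lone factor
  \<open>s\<close> on the left reflects \<open>f + 1 = c + n\<close>.\<close>

lemma det_smult_one_minus_sum_projections:
  fixes U :: "complex mat"
  assumes U: "U \<in> carrier_mat f c" and U': "U' \<in> carrier_mat c f"
    and V: "V \<in> carrier_mat f n" and W: "W \<in> carrier_mat n f"
    and U'U: "U' * U = 1\<^sub>m c" and WV: "W * V = 1\<^sub>m n"
    and dims: "f + 1 = c + n" "c \<le> n" and s: "s \<noteq> 0" "s \<noteq> 1"
  shows "s * det (s \<cdot>\<^sub>m 1\<^sub>m f - (U * U' + V * W)) =
           (s - 1) ^ (n - c) * det ((s - 1)\<^sup>2 \<cdot>\<^sub>m 1\<^sub>m c - (U' * V) * (W * U))"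
proof -
  define u where "u = s - 1"
  have u: "u \<noteq> 0" "s = u + 1" using s by (auto simp: u_def)
  define P where "P = U * U'"
  define K where "K = u \<cdot>\<^sub>m 1\<^sub>m f + P"
  define D where "D = s \<cdot>\<^sub>m 1\<^sub>m f - (P + V * W)"
  have P: "P \<in> carrier_mat f f" and K: "K \<in> carrier_mat f f"
    and VW: "V * W \<in> carrier_mat f f" and WK: "W * K \<in> carrier_mat n f"
    and D: "D \<in> carrier_mat f f" and VWK: "V * (W * K) \<in> carrier_mat f f"
    and UV: "U' * V \<in> carrier_mat c n" and WU: "W * U \<in> carrier_mat n c"
    unfolding P_def K_def D_def using U U' V W by (auto intro!: minus_carrier_mat)
  have PP: "P * P = P"
  proof -
    have "P * P = U * (U' * (U * U'))"
      unfolding P_def using U U' by (intro assoc_mult_mat) auto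
    also have "U' * (U * U') = (U' * U) * U'"
      using U U' by (intro assoc_mult_mat[symmetric]) auto
    finally show ?thesis using U U' by (simp add: U'U P_def)
  qed
  have PK: "P * K = s \<cdot>\<^sub>m P"
  proof -
    have "P * K = P * (u \<cdot>\<^sub>m 1\<^sub>m f) + P * P"
      unfolding K_def using P by (intro mult_add_distrib_mat) auto
    also have "P * (u \<cdot>\<^sub>m 1\<^sub>m f) = u \<cdot>\<^sub>m P"
      using P by (subst mult_smult_distrib) auto
    finally show ?thesis
      using P by (intro eq_matI) (auto simp: PP u algebra_simps)
  qed
  have DK: "D * K = (s * u) \<cdot>\<^sub>m 1\<^sub>m f - V * (W * K)"
  proof -
    have "D * K = (s \<cdot>\<^sub>m 1\<^sub>m f) * K - (P + V * W) * K"
      unfolding D_def using P K VW by (intro minus_mult_distrib_mat) auto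
    also have "(s \<cdot>\<^sub>m 1\<^sub>m f) * K = s \<cdot>\<^sub>m K"
      using K by (subst mult_smult_assoc_mat) auto
    also have "(P + V * W) * K = P * K + (V * W) * K"
      using P K VW by (intro add_mult_distrib_mat) auto
    also have "(V * W) * K = V * (W * K)"
      using V W K by (intro assoc_mult_mat) auto
    finally have "D * K = s \<cdot>\<^sub>m K - (s \<cdot>\<^sub>m P + V * (W * K))" by (simp add: PK)
    also have "\<dots> = (s * u) \<cdot>\<^sub>m 1\<^sub>m f - V * (W * K)"
    proof (rule eq_matI)
      fix i j assume "i < dim_row ((s * u) \<cdot>\<^sub>m 1\<^sub>m f - V * (W * K))" "j < dim_col ((s * u) \<cdot>\<^sub>m 1\<^sub>m f - V * (W * K))"
      hence ij: "i < f" "j < f" using VWK by auto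
      have k: "K $$ (i, j) = (if i = j then u else 0) + P $$ (i, j)"
        unfolding K_def using ij P by auto
      have "(s \<cdot>\<^sub>m K - (s \<cdot>\<^sub>m P + V * (W * K))) $$ (i, j) = s * K $$ (i, j) - (s * P $$ (i, j) + (V * (W * K)) $$ (i, j))"
        using ij P K carrier_matD[OF VWK] by (simp del: index_mult_mat(1))
      also have "\<dots> = ((s * u) \<cdot>\<^sub>m 1\<^sub>m f - V * (W * K)) $$ (i, j)"
        using ij carrier_matD[OF VWK] by (simp del: index_mult_mat(1) add: k algebra_simps)
      finally show "(s \<cdot>\<^sub>m K - (s \<cdot>\<^sub>m P + V * (W * K))) $$ (i, j) = ((s * u) \<cdot>\<^sub>m 1\<^sub>m f - V * (W * K)) $$ (i, j)" .
    qed (use VWK K P in auto)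
    finally show ?thesis .
  qed
  have WKV: "(W * K) * V = u \<cdot>\<^sub>m 1\<^sub>m n + (W * U) * (U' * V)"
  proof -
    have "W * K = W * (u \<cdot>\<^sub>m 1\<^sub>m f) + W * P"
      unfolding K_def using P W by (intro mult_add_distrib_mat) auto
    also have "W * (u \<cdot>\<^sub>m 1\<^sub>m f) = u \<cdot>\<^sub>m W"
      using W by (subst mult_smult_distrib) auto
    finally have "(W * K) * V = (u \<cdot>\<^sub>m W) * V + (W * P) * V"
      using W P V by (metis add_mult_distrib_mat mult_carrier_mat smult_carrier_mat)
    also have "(u \<cdot>\<^sub>m W) * V = u \<cdot>\<^sub>m 1\<^sub>m n"
      using W V by (subst mult_smult_assoc_mat) (auto simp: WV)
    also have "(W * P) * V = W * (P * V)"
      using W P V by (intro assoc_mult_mat) auto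
    also have "P * V = U * (U' * V)"
      unfolding P_def using U U' V by (intro assoc_mult_mat) auto
    also have "W * (U * (U' * V)) = (W * U) * (U' * V)"
      using W U UV by (intro assoc_mult_mat[symmetric]) auto
    finally show ?thesis .
  qed
  have "u ^ c * det (u \<cdot>\<^sub>m 1\<^sub>m f - (- U) * U') = u ^ f * det (u \<cdot>\<^sub>m 1\<^sub>m c - U' * (- U))"
    using U U' by (intro det_smult_one_minus_mult_commute) auto
  also have "u \<cdot>\<^sub>m 1\<^sub>m f - (- U) * U' = K"
    unfolding K_def P_def using U U' by (intro eq_matI) (auto)
  also have "u \<cdot>\<^sub>m 1\<^sub>m c - U' * (- U) = s \<cdot>\<^sub>m 1\<^sub>m c"
    using U U' by (simp add: U'U) (intro eq_matI, auto simp: u)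
  finally have det_K: "u ^ c * det K = u ^ f * s ^ c" by simp
  have "(s * u) ^ n * det ((s * u) \<cdot>\<^sub>m 1\<^sub>m f - V * (W * K)) =
        (s * u) ^ f * det ((s * u) \<cdot>\<^sub>m 1\<^sub>m n - (W * K) * V)"
    using V WK by (intro det_smult_one_minus_mult_commute) auto
  also have "(s * u) \<cdot>\<^sub>m 1\<^sub>m n - (W * K) * V = u\<^sup>2 \<cdot>\<^sub>m 1\<^sub>m n - (W * U) * (U' * V)"
    unfolding WKV using carrier_matD[OF WU] carrier_matD[OF UV]
    by (intro eq_matI) (auto simp: u algebra_simps power2_eq_square simp del: index_mult_mat(1))
  finally have det_D: "(s * u) ^ n * (det D * det K) = (s * u) ^ f * det (u\<^sup>2 \<cdot>\<^sub>m 1\<^sub>m n - (W * U) * (U' * V))"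
    by (simp add: DK[symmetric] det_mult[OF D K])
  have det_2: "(u\<^sup>2) ^ c * det (u\<^sup>2 \<cdot>\<^sub>m 1\<^sub>m n - (W * U) * (U' * V)) =
        (u\<^sup>2) ^ n * det (u\<^sup>2 \<cdot>\<^sub>m 1\<^sub>m c - (U' * V) * (W * U))"
    using UV WU by (intro det_smult_one_minus_mult_commute) auto
  define d k d2 d3 where "d = det D" and "k = det K"
    and "d2 = det (u\<^sup>2 \<cdot>\<^sub>m 1\<^sub>m n - (W * U) * (U' * V))"
    and "d3 = det (u\<^sup>2 \<cdot>\<^sub>m 1\<^sub>m c - (U' * V) * (W * U))"
  note eqs = det_K[folded k_def] det_D[folded k_def d_def d2_def] det_2[folded d2_def d3_def]
  obtain e where e: "n = c + e" using dims le_Suc_ex by blast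
  \<comment> \<open>The ranks exceed the dimension by one in total, which is traded here for the
    factor \<open>s\<close>. The remaining powers of \<open>s\<close> and \<open>u\<close> form a
    common nonzero factor.\<close>
  have sf: "s ^ f * s = s ^ n * s ^ c"
    using dims by (metis add.commute power_add power_one_right)
  have "(s ^ f * u ^ n * u ^ f * (u\<^sup>2) ^ c) * (s * d) = (s * u) ^ n * d * (u ^ f * s ^ c) * (u\<^sup>2) ^ c"
    using sf by (simp add: power_mult_distrib)
  also have "\<dots> = u ^ c * ((s * u) ^ n * (d * k)) * (u\<^sup>2) ^ c"
    by (simp add: eqs(1)[symmetric])
  also have "\<dots> = u ^ c * (s * u) ^ f * ((u\<^sup>2) ^ c * d2)"
    by (simp add: eqs(2))
  also have "\<dots> = u ^ c * (s * u) ^ f * ((u\<^sup>2) ^ n * d3)"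
    by (simp add: eqs(3))
  also have "\<dots> = (s ^ f * u ^ n * u ^ f * (u\<^sup>2) ^ c) * (u ^ e * d3)"
    unfolding e by (simp add: power_add power_mult_distrib power2_eq_square)
  finally have "s * d = u ^ e * d3"
    using s u by simp
  thus ?thesis by (simp add: e d_def d3_def D_def P_def u_def)
qed

text \<open>The scalar \<open>a\<close> lets one formula cover a matrix itself and the multiples of
  the cell matrix by \<open>1 / m\<close> and \<open>- 1 / (m - 1)\<close>. The case
  \<open>a = 0\<close> is separate because the characteristic polynomial is evaluated at
  \<open>y / a\<close>.\<close>

lemma det_smult_one_minus_smult:
  fixes G :: "complex mat"
  assumes G: "G \<in> carrier_mat c c"
  shows "det (y \<cdot>\<^sub>m 1\<^sub>m c - a \<cdot>\<^sub>m G) = (\<Prod>w\<in>#proots (char_poly G). y - a * w)"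
proof -
  let ?M = "proots (char_poly G)"
  have size: "size ?M = c"
    using degree_monic_char_poly[OF G] by (simp add: size_proots_complex)
  show ?thesis
  proof (cases "a = 0")
    case True
    have "y \<cdot>\<^sub>m 1\<^sub>m c - a \<cdot>\<^sub>m G = y \<cdot>\<^sub>m 1\<^sub>m c" using G True by (intro eq_matI) auto
    thus ?thesis using size True by (simp add: image_mset_const_eq)
  next
    case False
    have "char_poly G = (\<Prod>w\<in>#?M. [:-w, 1:])"
      using complex_poly_decompose_multiset[of "char_poly G"] degree_monic_char_poly[OF G] by simp
    hence "poly (char_poly G) (y / a) = poly (\<Prod>w\<in>#?M. [:-w, 1:]) (y / a)" by simp
    also have "\<dots> = (\<Prod>w\<in>#?M. y / a - w)"
      by (induction ?M) (simp_all add: poly_prod_mset image_mset.compositionality o_def)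
    finally have "(\<Prod>w\<in>#?M. y / a - w) = det (- char_matrix G (y / a))"
      using char_poly_matrix[OF G] by simp
    hence "a ^ c * (\<Prod>w\<in>#?M. y / a - w) = det (a \<cdot>\<^sub>m (- char_matrix G (y / a)))"
      using G by (simp add: char_matrix_def)
    also have "a \<cdot>\<^sub>m (- char_matrix G (y / a)) = y \<cdot>\<^sub>m 1\<^sub>m c - a \<cdot>\<^sub>m G"
      using G False by (intro eq_matI) (auto simp: char_matrix_def algebra_simps)
    also have "a ^ c * (\<Prod>w\<in>#?M. y / a - w) = (\<Prod>w\<in>#?M. a * (y / a - w))"
      using size by (simp add: prod_mset.distrib image_mset_const_eq)
    also have "\<dots> = (\<Prod>w\<in>#?M. y - a * w)"
      using False by (simp add: algebra_simps)
    finally show ?thesis by simp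
  qed
qed

text \<open>Polynomials that agree off a finite set coincide, so the parameters excluded from a
  determinant identity cost no information about multiplicities.\<close>

lemma multiset_eq_if_prod_linear_eq:
  fixes A B :: "complex multiset"
  assumes S: "finite S" and eq: "\<And>t. t \<notin> S \<Longrightarrow> (\<Prod>a\<in>#A. t - a) = (\<Prod>b\<in>#B. t - b)"
  shows "A = B"
proof -
  define p where "p M = (\<Prod>a\<in>#M. [:-a, 1:])" for M :: "complex multiset"
  have p: "poly (p M) t = (\<Prod>a\<in>#M. t - a)" "proots (p M) = M" "p M \<noteq> 0" for M t
    unfolding p_def
    by (induction M) (auto simp del: mult_pCons_left simp: proots_mult)
  have "p A = p B"
  proof (rule ccontr)
    assume "p A \<noteq> p B"
    hence "finite {t. poly (p A - p B) t = 0}" by (intro poly_roots_finite) simp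
    moreover have "- S \<subseteq> {t. poly (p A - p B) t = 0}" using eq by (auto simp: p(1))
    ultimately have "finite (S \<union> - S)" using S finite_subset by blast
    thus False by (simp add: infinite_UNIV_char_0)
  qed
  thus ?thesis using p(2) by metis
qed

section \<open>Cells and vertices\<close>

lemma nth_concat_equal_length:
  assumes "\<And>xs. xs \<in> set xss \<Longrightarrow> length xs = m" "k < length xss" "i < m"
  shows "concat xss ! (k * m + i) = xss ! k ! i"
  using assms
proof (induction xss arbitrary: k)
  case (Cons xs xss)
  show ?case
  proof (cases k)
    case (Suc k')
    have "length xs = m" using Cons.prems by simp
    moreover have "concat xss ! (k' * m + i) = xss ! k' ! i"
      using Cons.IH[of k'] Cons.prems Suc by simp
    ultimately show ?thesis
      using Suc by (simp add: nth_append add.assoc)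
  qed (use Cons.prems in \<open>simp add: nth_append\<close>)
qed simp

lemma sum_div_mod:
  "(\<Sum>q<c * m. g (q div m) (q mod m)) = (\<Sum>k<c. \<Sum>i<m. g k i)"
  for g :: "nat \<Rightarrow> nat \<Rightarrow> 'a :: comm_monoid_add"
proof -
  have "(\<Sum>q<c * m. g (q div m) (q mod m)) = (\<Sum>k<c. \<Sum>q=k*m..<k*m+m. g (q div m) (q mod m))"
    by (rule sum.nat_group[symmetric])
  moreover have "(\<Sum>q=k*m..<k*m+m. g (q div m) (q mod m)) = (\<Sum>i<m. g k i)" for k
    using sum.shift_bounds_nat_ivl[of "\<lambda>q. g (q div m) (q mod m)" 0 "k*m" m]
    by (simp add: add.commute lessThan_atLeast0)
  ultimately show ?thesis by simp
qed

lemma sum_nth_distinct: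
  "distinct xs \<Longrightarrow> (\<Sum>i<length xs. g (xs ! i)) = (\<Sum>x\<in>set xs. g x)"
  for g :: "'b \<Rightarrow> 'a :: comm_monoid_add"
  by (simp add: sum_list_distinct_conv_sum_set[symmetric] sum_list_sum_nth lessThan_atLeast0)

lemma mat_mult_mat:
  "mat a b f * mat b c g = mat a c (\<lambda>(i, j). \<Sum>k<b. f (i, k) * g (k, j))"
  for f :: "nat \<times> nat \<Rightarrow> 'a :: semiring_0"
  by (rule eq_matI) (auto simp: scalar_prod_def lessThan_atLeast0)

declare vertex_count.simps(2) [simp del] cells.simps(2) [simp del]

lemma length_cells: "length (cells m n) = m ^ n"
  by (induction n) (auto simp: cells.simps(2) length_concat subdivide_cell_def o_def sum_list_triv)

lemma vertex_count_eq:
  assumes "m \<ge> 2" shows "vertex_count m n = (m - 1) * m ^ n + 1"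
proof (induction n)
  case (Suc n)
  obtain l where l: "m = 2 + l" using assms le_Suc_ex by blast
  show ?case
    unfolding vertex_count.simps Suc.IH length_cells by (simp add: l algebra_simps)
qed (use assms in simp)

text \<open>Position \<open>q\<close> encodes a flag: the parent cell \<open>q div m\<close> and the
  position \<open>q mod m\<close> of the old vertex that the new cell keeps. Later sums over cells
  of the next level are sums over flags in this encoding.\<close>

lemma cells_Suc_nth:
  assumes "q < m ^ n * m"
  shows "cells m (Suc n) ! q =
           (let s = vertex_count m n + (q div m) * (1 + m * (m - 2)); i = q mod m
            in cells m n ! (q div m) ! i # s # [s + 1 + i * (m - 2) ..< s + 1 + (i + 1) * (m - 2)])"
proof -
  have m: "m > 0" using assms by (cases m) auto
  have k: "q div m < m ^ n" and i: "q mod m < m"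
    using assms m by (simp_all add: less_mult_imp_div_less)
  have "cells m (Suc n) ! (q div m * m + q mod m) =
    map (\<lambda>k. subdivide_cell m (vertex_count m n + k * (1 + m * (m - 2))) (cells m n ! k))
       [0..<length (cells m n)] ! (q div m) ! (q mod m)"
    unfolding cells.simps using k i
    by (intro nth_concat_equal_length) (auto simp: subdivide_cell_def length_cells)
  thus ?thesis using k i by (simp add: length_cells subdivide_cell_def Let_def)
qed

text \<open>The three facts need a joint induction: a new cell has no repetition because its kept
  vertex lies below the old vertex count, hence below all fresh numbers.\<close>

lemma cells_wf:
  assumes m: "m \<ge> 2" and "k < m ^ n"
  shows "length (cells m n ! k) = m" "distinct (cells m n ! k)"
    "\<And>x. x \<in> set (cells m n ! k) \<Longrightarrow> x < vertex_count m n"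
proof -
  have "length (cells m n ! k) = m \<and> distinct (cells m n ! k) \<and>
    (\<forall>x \<in> set (cells m n ! k). x < vertex_count m n)"
    using assms(2)
  proof (induction n arbitrary: k)
    case (Suc n)
    define s where "s = vertex_count m n + (k div m) * (1 + m * (m - 2))"
    define i where "i = k mod m"
    have i: "i < m" using m by (simp add: i_def)
    have k: "k div m < m ^ n" using Suc.prems
      by (simp add: mult.commute less_mult_imp_div_less)
    note IH = Suc.IH[OF k]
    have "cells m n ! (k div m) ! i \<in> set (cells m n ! (k div m))" using IH i by simp
    hence old: "cells m n ! (k div m) ! i < vertex_count m n" using IH by blast
    have eq: "cells m (Suc n) ! k =
      cells m n ! (k div m) ! i # s # [s + 1 + i * (m - 2) ..< s + 1 + (i + 1) * (m - 2)]"
      using cells_Suc_nth[of k m n] Suc.prems by (simp add: s_def i_def Let_def mult.commute)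
    have "(i + 1) * (m - 2) \<le> m * (m - 2)" using i by (intro mult_right_mono) auto
    moreover have "(k div m + 1) * (1 + m * (m - 2)) \<le> m ^ n * (1 + m * (m - 2))"
      using k by (intro mult_right_mono) auto
    ultimately have "s + 1 + (i + 1) * (m - 2) \<le> vertex_count m (Suc n)"
      by (simp add: s_def length_cells vertex_count.simps(2))
    moreover obtain l where "m = l + 2" using m by (metis add.commute le_Suc_ex)
    ultimately show ?case unfolding eq using old by (auto simp: s_def)
  qed auto
  thus "length (cells m n ! k) = m" "distinct (cells m n ! k)"
    "\<And>x. x \<in> set (cells m n ! k) \<Longrightarrow> x < vertex_count m n" by blast+
qed

section \<open>Old and new vertices in the cells of the next level\<close>

context
  fixes m n :: nat
  assumes m: "m \<ge> 3"
begin

lemma flag_bounds: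
  assumes "q < m ^ n * m"
  shows "q div m < m ^ n" "q mod m < m" "cells m n ! (q div m) ! (q mod m) \<in> set (cells m n ! (q div m))"
    "cells m n ! (q div m) ! (q mod m) < vertex_count m n"
proof -
  show *: "q div m < m ^ n" "q mod m < m"
    using assms m by (simp_all add: less_mult_imp_div_less)
  show "cells m n ! (q div m) ! (q mod m) \<in> set (cells m n ! (q div m))"
    using * cells_wf[of m "q div m" n] m by simp
  thus "cells m n ! (q div m) ! (q mod m) < vertex_count m n"
    using * cells_wf[of m "q div m" n] m by simp
qed

lemma old_vertex_mem:
  assumes "q < m ^ n * m" "x < vertex_count m n"
  shows "x \<in> set (cells m (Suc n) ! q) \<longleftrightarrow> cells m n ! (q div m) ! (q mod m) = x"
  using assms(2) unfolding cells_Suc_nth[OF assms(1)] by (auto simp: Let_def)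

text \<open>The fresh vertices of an old cell form a block of \<open>1 + m * (m - 2)\<close>
  consecutive numbers, so division by the block length recovers the parent cell.\<close>

lemma new_vertex_mem_div:
  assumes q: "q < m ^ n * m" and r: "r < 1 + m * (m - 2)"
    and mem: "vertex_count m n + k * (1 + m * (m - 2)) + r \<in> set (cells m (Suc n) ! q)"
  shows "q div m = k"
proof -
  define d where "d = 1 + m * (m - 2)"
  define i where "i = q mod m"
  note b = flag_bounds[OF q, folded i_def]
  obtain l where l: "m - 2 = l" by blast
  have il: "l + i * l < d"
    using mult_right_mono[of "i + 1" m l] b(2) by (simp add: d_def l)
  hence "\<exists>r'<d. k * d + r = (q div m) * d + r'"
    using mem b(4) unfolding cells_Suc_nth[OF q] Let_def unfolding d_def[symmetric] i_def[symmetric] unfolding l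
    by (intro exI[of _ "k * d + r - (q div m) * d"]) (auto simp: algebra_simps)
  then obtain r' where r': "r' < d" "k * d + r = (q div m) * d + r'" by blast
  have "(k * d + r) div d = k" using r[folded d_def] by simp
  moreover have "((q div m) * d + r') div d = q div m" using r'(1) by simp
  ultimately show ?thesis using r' by simp
qed

lemma center_mem:
  assumes q: "q < m ^ n * m"
  shows "vertex_count m n + k * (1 + m * (m - 2)) \<in> set (cells m (Suc n) ! q) \<longleftrightarrow> q div m = k"
  using new_vertex_mem_div[OF q, of 0 k] unfolding cells_Suc_nth[OF q] by (auto simp: Let_def)

lemma further_mem:
  assumes q: "q < m ^ n * m" and i: "i < m" and j: "j < m - 2"
  shows "vertex_count m n + k * (1 + m * (m - 2)) + (1 + (i * (m - 2) + j)) \<in> set (cells m (Suc n) ! q)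
    \<longleftrightarrow> q div m = k \<and> q mod m = i"
    (is "?x \<in> ?C \<longleftrightarrow> ?R")
proof
  have "(i + 1) * (m - 2) \<le> m * (m - 2)" using i by (intro mult_right_mono) auto
  hence r: "1 + (i * (m - 2) + j) < 1 + m * (m - 2)" using j by simp
  assume mem: "?x \<in> ?C"
  have k: "q div m = k" by (rule new_vertex_mem_div[OF q r mem])
  have "(q mod m) * (m - 2) \<le> i * (m - 2) + j" "i * (m - 2) + j < (q mod m + 1) * (m - 2)"
    using mem flag_bounds[OF q] k unfolding cells_Suc_nth[OF q] by (auto simp: Let_def)
  hence "(i * (m - 2) + j) div (m - 2) = q mod m"
    by (intro div_nat_eqI) (auto simp: mult.commute)
  moreover have "(i * (m - 2) + j) div (m - 2) = i" using j by simp
  ultimately show ?R using k by simp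
next
  assume ?R
  moreover obtain l where "m - 2 = l" by blast
  ultimately show "?x \<in> ?C" unfolding cells_Suc_nth[OF q] using j by (auto simp: Let_def)
qed

text \<open>Old vertices, centers and further vertices lie in different numbers of cells. Separating
  them here produces the three terms in the recursion for the cell matrix.\<close>

lemma sum_vertices_Suc:
  "(\<Sum>x<vertex_count m (Suc n). g x) =
     (\<Sum>x<vertex_count m n. g x) +
     (\<Sum>k<m ^ n. g (vertex_count m n + k * (1 + m * (m - 2))) +
        (\<Sum>i<m. \<Sum>j<m - 2. g (vertex_count m n + k * (1 + m * (m - 2)) + (1 + (i * (m - 2) + j)))))"
  for g :: "nat \<Rightarrow> 'a :: comm_monoid_add"
proof -
  define d where "d = 1 + m * (m - 2)"
  define N where "N = vertex_count m n"
  have grp: "(\<Sum>x<c * b. h x) = (\<Sum>k<c. \<Sum>r<b. h (k * b + r))" for c b and h :: "nat \<Rightarrow> 'a"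
  proof -
    have "(\<Sum>x=k*b..<k*b+b. h x) = (\<Sum>r<b. h (k * b + r))" for k
      using sum.shift_bounds_nat_ivl[of h 0 "k*b" b] by (simp add: add.commute lessThan_atLeast0)
    thus ?thesis using sum.nat_group[of h b c] by simp
  qed
  have "(\<Sum>x<vertex_count m (Suc n). g x) = (\<Sum>x<N + m ^ n * d. g x)"
    by (simp add: N_def d_def length_cells vertex_count.simps(2))
  also have "\<dots> = (\<Sum>x<N. g x) + (\<Sum>x<m ^ n * d. g (N + x))"
    using sum.shift_bounds_nat_ivl[of g 0 N "m ^ n * d"]
      sum.atLeastLessThan_concat[of 0 N "N + m ^ n * d" g]
    by (simp add: add.commute lessThan_atLeast0)
  also have "(\<Sum>x<m ^ n * d. g (N + x)) = (\<Sum>k<m^n. \<Sum>r<d. g (N + (k * d + r)))"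
    by (rule grp)
  also have "(\<lambda>k. \<Sum>r<d. g (N + (k * d + r))) = (\<lambda>k.
    g (N + k * d) + (\<Sum>i<m. \<Sum>j<m - 2. g (N + k * d + (1 + (i * (m - 2) + j)))))"
  proof
    fix k
    have "(\<Sum>r<d. g (N + (k * d + r))) = g (N + k * d) + (\<Sum>r<m * (m - 2). g (N + (k * d + Suc r)))"
      unfolding d_def plus_1_eq_Suc by (subst sum.lessThan_Suc_shift) simp
    also have "(\<Sum>r<m * (m - 2). g (N + (k * d + Suc r))) =
      (\<Sum>i<m. \<Sum>j<m - 2. g (N + k * d + (1 + (i * (m - 2) + j))))"
      by (subst grp) (simp add: add.assoc)
    finally show "(\<Sum>r<d. g (N + (k * d + r))) =
      g (N + k * d) + (\<Sum>i<m. \<Sum>j<m - 2. g (N + k * d + (1 + (i * (m - 2) + j))))" .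
  qed
  finally show ?thesis unfolding N_def d_def .
qed

text \<open>Double counting of incidences: since a cell has no repetitions, its positions and its
  vertices correspond one to one.\<close>

lemma sum_flags_nth:
  fixes g :: "nat \<Rightarrow> nat \<Rightarrow> 'a :: comm_monoid_add"
  shows "(\<Sum>q<m ^ n * m. g (q div m) (cells m n ! (q div m) ! (q mod m))) =
    (\<Sum>k<m ^ n. \<Sum>x\<in>set (cells m n ! k). g k x)"
proof -
  have "(\<Sum>q<m ^ n * m. g (q div m) (cells m n ! (q div m) ! (q mod m))) =
    (\<Sum>k<m ^ n. \<Sum>i<m. g k (cells m n ! k ! i))"
    using sum_div_mod[where g = "\<lambda>k i. g k (cells m n ! k ! i)"] by simp
  also have "\<dots> = (\<Sum>k<m ^ n. \<Sum>x\<in>set (cells m n ! k). g k x)"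
  proof (rule sum.cong[OF refl])
    fix k assume "k \<in> {..<m ^ n}"
    thus "(\<Sum>i<m. g k (cells m n ! k ! i)) = (\<Sum>x\<in>set (cells m n ! k). g k x)"
      using sum_nth_distinct[of "cells m n ! k" "g k"] cells_wf[of m k n] m by simp
  qed
  finally show ?thesis .
qed

end

section \<open>The number of cells through a vertex, and shared vertices of cells\<close>

definition cell_degree :: "nat \<Rightarrow> nat \<Rightarrow> nat \<Rightarrow> nat" where
  "cell_degree m n x = (\<Sum>k<m ^ n. of_bool (x \<in> set (cells m n ! k)))"

context
  fixes m n :: nat
  assumes m: "m \<ge> 3"
begin

lemma sum_flags_at_vertex:
  "(\<Sum>q<m ^ n * m. of_bool (cells m n ! (q div m) ! (q mod m) = x)) = cell_degree m n x"
proof -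
  have "(\<Sum>q<m ^ n * m. of_bool (cells m n ! (q div m) ! (q mod m) = x)) =
    (\<Sum>k<m ^ n. \<Sum>y\<in>set (cells m n ! k). (of_bool (y = x) :: nat))"
    by (rule sum_flags_nth[OF m])
  also have "\<dots> = cell_degree m n x"
    unfolding cell_degree_def by (intro sum.cong) auto
  finally show ?thesis .
qed

text \<open>Each old cell through \<open>x\<close> leaves exactly one new cell through
  \<open>x\<close>. Hence the old degrees reappear unchanged in the next cell matrix.\<close>

lemma cell_degree_old:
  "x < vertex_count m n \<Longrightarrow> cell_degree m (Suc n) x = cell_degree m n x"
  unfolding sum_flags_at_vertex[symmetric] unfolding cell_degree_def
  by (intro sum.cong) (auto simp: old_vertex_mem[OF m] mult.commute)

lemma cell_degree_center:
  assumes "k < m ^ n"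
  shows "cell_degree m (Suc n) (vertex_count m n + k * (1 + m * (m - 2))) = m"
proof -
  have "cell_degree m (Suc n) (vertex_count m n + k * (1 + m * (m - 2))) =
    (\<Sum>q<m ^ n * m. of_bool (q div m = k))"
    unfolding cell_degree_def
    by (intro sum.cong[OF _ arg_cong[where f = of_bool]] center_mem[OF m]) (simp_all add: mult.commute)
  also have "\<dots> = (\<Sum>l<m ^ n. \<Sum>i<m. of_bool (l = k))"
    by (rule sum_div_mod)
  also have "\<dots> = m" using assms by (simp add: of_bool_def sum.delta if_distrib cong: if_cong)
  finally show ?thesis .
qed

lemma cell_degree_further:
  assumes "k < m ^ n" "i < m" "j < m - 2"
  shows "cell_degree m (Suc n) (vertex_count m n + k * (1 + m * (m - 2)) + (1 + (i * (m - 2) + j))) = 1"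
proof -
  have "cell_degree m (Suc n) (vertex_count m n + k * (1 + m * (m - 2)) + (1 + (i * (m - 2) + j))) =
    (\<Sum>q<m ^ n * m. of_bool (q div m = k \<and> q mod m = i))"
    unfolding cell_degree_def using assms
    by (intro sum.cong[OF _ arg_cong[where f = of_bool]] further_mem[OF m]) (simp_all add: mult.commute)
  also have "\<dots> = (\<Sum>l<m ^ n. \<Sum>i'<m. of_bool (l = k \<and> i' = i))"
    by (rule sum_div_mod)
  also have "\<dots> = (\<Sum>l<m ^ n. if l = k then \<Sum>i'<m. if i' = i then 1 else 0 else 0)"
    by (intro sum.cong) auto
  also have "\<dots> = 1" using assms by simp
  finally show ?thesis .
qed

end

text \<open>The number of a new vertex is decoded in mixed radix: first the block of its parent
  cell, then offset 0 for the center, or one more than the code of the pair \<open>i\<close>,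
  \<open>j\<close>.\<close>

lemma vertex_cases:
  assumes "m \<ge> 3" "x < vertex_count m (Suc n)"
  obtains "x < vertex_count m n"
  | k where "k < m ^ n" "x = vertex_count m n + k * (1 + m * (m - 2))"
  | k i j where "k < m ^ n" "i < m" "j < m - 2"
      "x = vertex_count m n + k * (1 + m * (m - 2)) + (1 + (i * (m - 2) + j))"
proof (cases "x < vertex_count m n")
  case False
  define d where "d = 1 + m * (m - 2)"
  define y where "y = x - vertex_count m n"
  have x: "x = vertex_count m n + y" using False by (simp add: y_def)
  have "y < m ^ n * d" using assms x by (simp add: length_cells d_def vertex_count.simps(2))
  hence k: "y div d < m ^ n" by (simp add: less_mult_imp_div_less)
  have r: "y mod d < d" by (simp add: d_def)
  have y: "y = (y div d) * d + y mod d" by simp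
  show ?thesis
  proof (cases "y mod d")
    case 0
    thus ?thesis using that(2)[OF k] x y unfolding d_def by simp
  next
    case (Suc z)
    have z: "z = (z div (m - 2)) * (m - 2) + z mod (m - 2)" by (rule div_mult_mod_eq[symmetric])
    have "z < m * (m - 2)" using Suc r by (simp add: d_def)
    hence "z div (m - 2) < m" by (simp add: less_mult_imp_div_less)
    moreover have "z mod (m - 2) < m - 2" using assms by simp
    moreover have "x = vertex_count m n + (y div d) * d + (1 + ((z div (m - 2)) * (m - 2) + z mod (m - 2)))"
      using x y Suc z by simp
    ultimately show ?thesis using that(3)[OF k] unfolding d_def by blast
  qed
qed (use that in auto)

lemma cell_degree_pos:
  assumes m: "m \<ge> 3" and x: "x < vertex_count m n"
  shows "cell_degree m n x > 0"
  using x
proof (induction n)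
  case 0
  thus ?case by (simp add: cell_degree_def)
next
  case (Suc n)
  from m Suc.prems show ?case
  proof (cases rule: vertex_cases)
    case 1
    thus ?thesis using Suc.IH cell_degree_old[OF m] by simp
  next
    case (2 k)
    thus ?thesis using cell_degree_center[OF m 2(1)] m by simp
  next
    case (3 k i j)
    thus ?thesis using cell_degree_further[OF m 3(1-3)] by simp
  qed
qed

text \<open>A vertex shared by two different new cells is the center if their parents agree and the
  kept old vertex if their parents differ. The parents thus leave a single candidate, and a case
  split on \<open>n\<close> replaces induction.\<close>

lemma common_cell_unique:
  assumes m: "m \<ge> 3" and "k < m ^ n" "l < m ^ n" "x \<noteq> y"
    and x: "x \<in> set (cells m n ! k)" "x \<in> set (cells m n ! l)"
    and y: "y \<in> set (cells m n ! k)" "y \<in> set (cells m n ! l)"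
  shows "k = l"
proof (cases n)
  case (Suc n')
  have kl: "k < m ^ n' * m" "l < m ^ n' * m" using assms Suc by (simp_all add: mult.commute)
  have single: "k = l \<or> (v < vertex_count m n' \<and> k div m \<noteq> l div m \<and>
        cells m n' ! (k div m) ! (k mod m) = v) \<or>
      (k div m = l div m \<and> v = vertex_count m n' + (k div m) * (1 + m * (m - 2)))"
    if v: "v \<in> set (cells m n ! k)" "v \<in> set (cells m n ! l)" for v
  proof -
    have "v < vertex_count m (Suc n')"
      using cells_wf(3)[of m k n v] assms v Suc by simp
    from m this show ?thesis
    proof (cases rule: vertex_cases)
      case 1
      note mem = old_vertex_mem[OF m kl(1) 1] old_vertex_mem[OF m kl(2) 1]
      have eq: "cells m n' ! (k div m) ! (k mod m) = v" "cells m n' ! (l div m) ! (l mod m) = v"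
        using mem v Suc by auto
      have "k = l" if "k div m = l div m"
      proof -
        note b = flag_bounds[OF m kl(1)] flag_bounds[OF m kl(2)]
        have "length (cells m n' ! (k div m)) = m" "distinct (cells m n' ! (k div m))"
          using cells_wf[of m "k div m" n'] b m by simp_all
        hence "k mod m = l mod m"
          using eq that b nth_eq_iff_index_eq[of "cells m n' ! (k div m)" "k mod m" "l mod m"] by simp
        thus ?thesis using that by (metis div_mult_mod_eq)
      qed
      thus ?thesis using eq 1 by blast
    next
      case (2 j)
      thus ?thesis using v Suc center_mem[OF m kl(1), of j] center_mem[OF m kl(2), of j] by auto
    next
      case (3 j i r)
      thus ?thesis using v Suc further_mem[OF m kl(1) 3(2,3), of j] further_mem[OF m kl(2) 3(2,3), of j]
        by (metis div_mult_mod_eq)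
    qed
  qed
  show ?thesis using single[OF x] single[OF y] assms(4) by auto
qed (use assms in auto)

section \<open>Averages over roots and the eigenvalue measures\<close>

lemma expectation_bind_pmf:
  fixes f :: "'a \<Rightarrow> real"
  assumes "\<And>x. \<bar>f x\<bar> \<le> B"
  shows "measure_pmf.expectation (bind_pmf p g) f =
    measure_pmf.expectation p (\<lambda>x. measure_pmf.expectation (g x) f)"
  unfolding measure_pmf_bind using assms
  by (intro integral_bind[where K = "count_space UNIV" and B = B and B' = 1])
     (auto simp: measure_pmf.emeasure_space_1 measure_pmf_in_subprob_algebra)

lemma integrable_measure_pmf_bounded:
  fixes f :: "'a \<Rightarrow> real"
  assumes "\<And>x. \<bar>f x\<bar> \<le> B"
  shows "integrable (measure_pmf p) f"
  using assms by (intro measure_pmf.integrable_const_bound[where B = B]) auto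

lemma abs_expectation_le:
  fixes f :: "'a \<Rightarrow> real"
  assumes "\<And>x. \<bar>f x\<bar> \<le> B"
  shows "\<bar>measure_pmf.expectation p f\<bar> \<le> B"
  unfolding abs_le_iff
proof
  show "measure_pmf.expectation p f \<le> B"
    using assms by (intro measure_pmf.integral_le_const integrable_measure_pmf_bounded[OF assms]) (auto simp: abs_le_iff)
  have "measure_pmf.expectation p f \<ge> - B"
    using assms by (intro measure_pmf.integral_ge_const integrable_measure_pmf_bounded[OF assms])
      (auto simp: abs_le_iff minus_le_iff)
  thus "- measure_pmf.expectation p f \<le> B" by simp
qed

section \<open>The limit law of the cell eigenvalues\<close>

definition root_step :: "nat \<Rightarrow> bool \<Rightarrow> complex \<Rightarrow> complex" where
  "root_step m b w = of_nat (m - 1) + (if b then 1 else - 1) * csqrt (w / of_nat m)"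

definition root_step_pmf :: "nat \<Rightarrow> complex \<Rightarrow> complex pmf" where
  "root_step_pmf m w = map_pmf (\<lambda>b. root_step m b w) (bernoulli_pmf (1 / 2))"

primrec root_walk_pmf :: "nat \<Rightarrow> nat \<Rightarrow> complex pmf" where
  "root_walk_pmf m 0 = return_pmf (of_nat (m - 1))"
| "root_walk_pmf m (Suc k) = bind_pmf (root_walk_pmf m k) (root_step_pmf m)"

text \<open>The walk starts at \<open>m - 1\<close>, the value of the fresh eigenvalues, and its
  length is the number of generations since then. Of about \<open>m ^ (n + 1)\<close> roots, about
  \<open>2 * m ^ n\<close> descend from older ones, so tracing ancestors stops with probability
  \<open>1 - 2 / m\<close>.\<close>

definition cell_limit_pmf :: "nat \<Rightarrow> complex pmf" where
  "cell_limit_pmf m = bind_pmf (geometric_pmf (1 - 2 / real m)) (root_walk_pmf m)"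

text \<open>Conditioning on the first geometric trial gives a fixed point equation: the last step of
  the walk is the outermost one, so after a failure there remains the whole law followed by one root
  step.\<close>

lemma cell_limit_pmf_unfold:
  assumes "m \<ge> 3"
  shows "cell_limit_pmf m = bind_pmf (bernoulli_pmf (1 - 2 / real m))
    (\<lambda>b. if b then return_pmf (of_nat (m - 1)) else bind_pmf (cell_limit_pmf m) (root_step_pmf m))"
proof -
  let ?G = "geometric_pmf (1 - 2 / real m)"
  have p: "1 - 2 / real m \<in> {0<..1}" using assms by (auto simp: field_simps)
  have "cell_limit_pmf m = bind_pmf (bernoulli_pmf (1 - 2 / real m))
     (\<lambda>b. if b then return_pmf 0 else map_pmf Suc ?G) \<bind> root_walk_pmf m"
    unfolding cell_limit_pmf_def using geometric_bind_pmf_unfold[OF p] by simp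
  also have "\<dots> = bind_pmf (bernoulli_pmf (1 - 2 / real m))
    (\<lambda>b. if b then root_walk_pmf m 0 else bind_pmf ?G (\<lambda>k. root_walk_pmf m (Suc k)))"
    unfolding bind_assoc_pmf
    by (intro bind_pmf_cong refl) (auto simp: bind_return_pmf bind_map_pmf)
  also have "root_walk_pmf m 0 = return_pmf (of_nat (m - 1))" by simp
  also have "bind_pmf ?G (\<lambda>k. root_walk_pmf m (Suc k)) = bind_pmf (cell_limit_pmf m) (root_step_pmf m)"
    by (simp add: cell_limit_pmf_def bind_assoc_pmf)
  finally show ?thesis .
qed

text \<open>The fair coin halves the weight \<open>2 / m\<close>, which leaves \<open>1 / m\<close>
  for the sum over both roots. This is the recursion for root averages without its vanishing
  correction terms.\<close>

lemma expectation_cell_limit_pmf: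
  fixes f :: "complex \<Rightarrow> real"
  assumes m: "m \<ge> 3" and f: "\<And>x. \<bar>f x\<bar> \<le> B"
  shows "measure_pmf.expectation (cell_limit_pmf m) f =
    (1 - 2 / m) * f (of_nat (m - 1)) +
    measure_pmf.expectation (cell_limit_pmf m) (\<lambda>w. f (root_step m True w) + f (root_step m False w)) / m"
proof -
  have p: "0 \<le> 1 - 2 / real m" "1 - 2 / real m \<le> 1" using m by (auto simp: field_simps)
  have step: "measure_pmf.expectation (root_step_pmf m w) f =
    (f (root_step m True w) + f (root_step m False w)) / 2" for w
    unfolding root_step_pmf_def by (simp add: field_simps)
  have "measure_pmf.expectation (cell_limit_pmf m) f =
    (1 - 2 / m) * f (of_nat (m - 1)) +
      2 / m * measure_pmf.expectation (bind_pmf (cell_limit_pmf m) (root_step_pmf m)) f"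
    by (subst cell_limit_pmf_unfold[OF m], subst expectation_bind_pmf[OF f])
       (use p in \<open>simp add: field_simps\<close>)
  also have "measure_pmf.expectation (bind_pmf (cell_limit_pmf m) (root_step_pmf m)) f =
    measure_pmf.expectation (cell_limit_pmf m) (\<lambda>w. f (root_step m True w) + f (root_step m False w)) / 2"
    by (subst expectation_bind_pmf[OF f]) (simp add: step)
  finally show ?thesis by simp
qed

text \<open>The recursion multiplies the sup norm of the test function by at most 2 while the number of
  roots grows by the factor m, so the averages contract with ratio 2 / m.\<close>

lemma root_average_bound:
  fixes W :: "nat \<Rightarrow> complex multiset" and f :: "complex \<Rightarrow> real"
  assumes m: "m \<ge> 3" and W0: "W 0 = {#w0#}"
    and WSuc: "\<And>n. add_mset a (W (Suc n)) =
        replicate_mset ((m - 2) * m ^ n + 1) (of_nat (m - 1)) +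
        image_mset (root_step m True) (W n) + image_mset (root_step m False) (W n)"
    and f: "\<And>x. \<bar>f x\<bar> \<le> B"
  shows "\<bar>(\<Sum>w\<in>#W n. f w) / real m ^ n - measure_pmf.expectation (cell_limit_pmf m) f\<bar>
    \<le> B * (4 * (2 / real m) ^ n - 2 / real m ^ n)"
  using f
proof (induction n arbitrary: f B)
  case 0
  show ?case using 0[of w0] abs_expectation_le[of f B "cell_limit_pmf m", OF 0] by (simp add: W0)
next
  case (Suc n)
  define Lf where "Lf = (\<lambda>w. f (root_step m True w) + f (root_step m False w))"
  define E :: "(complex \<Rightarrow> real) \<Rightarrow> real" where "E = measure_pmf.expectation (cell_limit_pmf m)"
  define M where "M = real m ^ n"
  define S where "S = (\<Sum>w\<in>#W n. Lf w)"
  define c where "c = (of_nat (m - 1) :: complex)"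
  have M: "M > 0" "real m > 0" using m by (auto simp: M_def)
  have Lf: "\<bar>Lf x\<bar> \<le> 2 * B" for x
    using Suc.prems[of "root_step m True x"] Suc.prems[of "root_step m False x"]
    unfolding Lf_def by linarith
  have IH: "\<bar>S / M - E Lf\<bar> \<le> 2 * B * (4 * (2 / real m) ^ n - 2 / real m ^ n)"
    using Suc.IH[OF Lf] by (simp add: E_def M_def S_def)
  have "(\<Sum>w\<in>#add_mset a (W (Suc n)). f w) = real ((m - 2) * m ^ n + 1) * f c + S"
    unfolding WSuc c_def S_def Lf_def by (simp add: sum_mset.distrib image_mset.compositionality o_def algebra_simps)
  hence sum: "(\<Sum>w\<in>#W (Suc n). f w) = ((real m - 2) * M + 1) * f c + S - f a"
    using m by (simp add: M_def of_nat_diff algebra_simps)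
  have "(\<Sum>w\<in>#W (Suc n). f w) / real m ^ Suc n - E f = (S / M - E Lf) / m + (f c - f a) / real m ^ Suc n"
    unfolding sum E_def expectation_cell_limit_pmf[OF m Suc.prems] Lf_def[symmetric] c_def[symmetric]
      power_Suc M_def[symmetric]
    using M by (simp add: field_simps)
  hence "\<bar>(\<Sum>w\<in>#W (Suc n). f w) / real m ^ Suc n - E f\<bar> \<le> \<bar>S / M - E Lf\<bar> / m + \<bar>f c - f a\<bar> / real m ^ Suc n"
    using abs_triangle_ineq[of "(S / M - E Lf) / m" "(f c - f a) / real m ^ Suc n"] M by (simp add: abs_divide)
  \<comment> \<open>With B factored out, the bounds obey e(n + 1) = 2 e(n) / m + 2 / m^(n + 1) and
    e(0) = 2, whose solution is the stated expression. The inhomogeneous term comes from the extra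
    copy of \<open>m - 1\<close> and the surplus root \<open>a\<close>.\<close>
  also have "\<dots> \<le> 2 * B * (4 * (2 / real m) ^ n - 2 / real m ^ n) / m + 2 * B / real m ^ Suc n"
    using IH Suc.prems[of c] Suc.prems[of a] by (intro add_mono divide_right_mono) (auto simp: abs_le_iff)
  also have "\<dots> = B * (4 * (2 / real m) ^ Suc n - 2 / real m ^ Suc n)"
    using M by (simp add: field_simps)
  finally show ?case unfolding E_def .
qed

lemma root_average_tendsto:
  fixes W :: "nat \<Rightarrow> complex multiset" and f :: "complex \<Rightarrow> real"
  assumes m: "m \<ge> 3" and W0: "W 0 = {#w0#}"
    and WSuc: "\<And>n. add_mset a (W (Suc n)) =
        replicate_mset ((m - 2) * m ^ n + 1) (of_nat (m - 1)) +
        image_mset (root_step m True) (W n) + image_mset (root_step m False) (W n)"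
    and f: "\<And>x. \<bar>f x\<bar> \<le> B"
  shows "(\<lambda>n. (\<Sum>w\<in>#W n. f w) / real m ^ n) \<longlonglongrightarrow> measure_pmf.expectation (cell_limit_pmf m) f"
proof -
  have "(\<lambda>n. B * (4 * (2 / real m) ^ n - 2 * (1 / real m) ^ n)) \<longlonglongrightarrow> B * (4 * 0 - 2 * 0)"
    using m by (intro tendsto_intros LIMSEQ_realpow_zero) auto
  hence "(\<lambda>n. B * (4 * (2 / real m) ^ n - 2 / real m ^ n)) \<longlonglongrightarrow> 0"
    by (simp add: power_divide)
  hence "(\<lambda>n. (\<Sum>w\<in>#W n. f w) / real m ^ n - measure_pmf.expectation (cell_limit_pmf m) f) \<longlonglongrightarrow> 0"
    using root_average_bound[of m W w0 a f B, OF m W0 WSuc f]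
    by (rule_tac Lim_null_comparison) (auto intro!: always_eventually)
  thus ?thesis by (simp add: LIM_zero_iff)
qed

section \<open>Eigenvalue measures as averages over roots\<close>

lemma sum_mset_conv_sum_count:
  "(\<Sum>x\<in>#M. f x) = (\<Sum>x\<in>set_mset M. real (count M x) * f x)" for f :: "'a \<Rightarrow> real"
proof (induction M)
  case (add x M)
  have "(\<Sum>y\<in>set_mset (add_mset x M). real (count (add_mset x M) y) * f y) =
    (\<Sum>y\<in>insert x (set_mset M). real (count M y) * f y + (if y = x then f x else 0))"
    by (intro sum.cong) (auto simp: algebra_simps)
  also have "\<dots> = (\<Sum>y\<in>insert x (set_mset M). real (count M y) * f y) + f x"
    by (subst sum.distrib) simp
  also have "(\<Sum>y\<in>insert x (set_mset M). real (count M y) * f y) = (\<Sum>y\<in>set_mset M. real (count M y) * f y)"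
    by (cases "x \<in># M") (auto simp: insert_absorb not_in_iff)
  finally show ?case using add by simp
qed simp

lemma laplacian_carrier: "laplacian m n \<in> carrier_mat (vertex_count m n) (vertex_count m n)"
  by (simp add: laplacian_def)

lemma char_poly_laplacian_nonzero: "char_poly (laplacian m n) \<noteq> 0"
  using degree_monic_char_poly[OF laplacian_carrier, of m n] by auto

lemma spectrum_laplacian: "spectrum (laplacian m n) = set_mset (proots (char_poly (laplacian m n)))"
  by (simp add: spectrum_root_char_poly[OF laplacian_carrier] char_poly_laplacian_nonzero)

lemma eigenvalue_mult_eq_0_iff: "eigenvalue_mult m n z = 0 \<longleftrightarrow> z \<notin> spectrum (laplacian m n)"
  by (simp add: eigenvalue_mult_def spectrum_root_char_poly[OF laplacian_carrier] order_root char_poly_laplacian_nonzero)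

text \<open>The points range over the spectra of all levels, but the weights vanish off the finite
  spectrum of level \<open>n\<close>. Mass and integral therefore reduce to finite sums.\<close>

lemma
  fixes f :: "complex \<Rightarrow> real"
  shows finite_borel_eigenvalue_measure: "finite_borel_measure (eigenvalue_measure m n)"
    and integral_eigenvalue_measure: "f \<in> borel_measurable borel \<Longrightarrow>
      integral\<^sup>L (eigenvalue_measure m n) f =
        (\<Sum>z\<in>#proots (char_poly (laplacian m n)). f z) / vertex_count m n"
proof -
  define w where "w = (\<lambda>z. real (eigenvalue_mult m n z) / real (vertex_count m n))"
  define S where "S = spectrum (laplacian m n)"
  have S: "finite S" "S \<subseteq> limit_spectrum m"
    unfolding S_def limit_spectrum_def by (auto simp: spectrum_laplacian)
  have w0: "w z = 0" if "z \<notin> S" for z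
    using that by (simp add: w_def S_def eigenvalue_mult_eq_0_iff[symmetric])
  have w_nonneg: "w z \<ge> 0" for z by (simp add: w_def)
  define P where "P = point_measure (limit_spectrum m) (\<lambda>z. ennreal (w z))"
  have eq: "eigenvalue_measure m n = distr P borel (\<lambda>z. z)"
    unfolding eigenvalue_measure_def P_def w_def ..
  have meas: "(\<lambda>z. z) \<in> P \<rightarrow>\<^sub>M borel" unfolding P_def by simp
  have fin: "finite {a \<in> limit_spectrum m. 0 < ennreal (w a)}"
    using w0 by (intro finite_subset[OF _ S(1)]) force
  have "emeasure P (space P) = (\<Sum>a | a \<in> limit_spectrum m \<and> 0 < ennreal (w a). ennreal (w a))"
    unfolding P_def space_point_measure using fin by (subst emeasure_point_measure) auto
  also have "\<dots> < \<infinity>" using fin by (simp add: sum_eq_0_iff less_top[symmetric])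
  finally have "finite_measure P" by (intro finite_measureI) simp
  thus "finite_borel_measure (eigenvalue_measure m n)"
    unfolding finite_borel_measure_def eq using finite_measure.finite_measure_distr[OF _ meas] by simp
  assume f: "f \<in> borel_measurable borel"
  have "integral\<^sup>L (eigenvalue_measure m n) f = integral\<^sup>L P f"
    unfolding eq by (rule integral_distr[OF meas f])
  also have "\<dots> = (\<integral>z. w z * f z \<partial>count_space (limit_spectrum m))"
    unfolding P_def point_measure_def by (subst integral_density) (auto simp: w_nonneg)
  also have "\<dots> = (\<Sum>z | z \<in> limit_spectrum m \<and> w z * f z \<noteq> 0. w z * f z)"
    using w0 by (intro lebesgue_integral_count_space_finite_support finite_subset[OF _ S(1)]) force
  also have "\<dots> = (\<Sum>z\<in>S. w z * f z)"
    using S w0 by (intro sum.mono_neutral_left) force+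
  also have "\<dots> = (\<Sum>z\<in>S. real (eigenvalue_mult m n z) * f z) / vertex_count m n"
    unfolding w_def sum_divide_distrib by simp
  also have "(\<Sum>z\<in>S. real (eigenvalue_mult m n z) * f z) = (\<Sum>z\<in>#proots (char_poly (laplacian m n)). f z)"
    unfolding sum_mset_conv_sum_count S_def spectrum_laplacian
    by (intro sum.cong) (auto simp: eigenvalue_mult_def char_poly_laplacian_nonzero)
  finally show "integral\<^sup>L (eigenvalue_measure m n) f =
        (\<Sum>z\<in>#proots (char_poly (laplacian m n)). f z) / vertex_count m n" .
qed

section \<open>The recursion for the cell eigenvalues\<close>

definition incidence_mat :: "nat \<Rightarrow> nat \<Rightarrow> complex mat" where
  "incidence_mat m n = mat (m ^ n) (vertex_count m n) (\<lambda>(k, x). of_bool (x \<in> set (cells m n ! k)))"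

text \<open>This is R^-1 B, while \<open>incidence_mat\<close> is the transpose of B: a function on
  cells is averaged over the cells through each vertex.\<close>

definition averaging_mat :: "nat \<Rightarrow> nat \<Rightarrow> complex mat" where
  "averaging_mat m n = mat (vertex_count m n) (m ^ n)
     (\<lambda>(x, k). of_bool (x \<in> set (cells m n ! k)) / of_nat (cell_degree m n x))"

definition cell_mat :: "nat \<Rightarrow> nat \<Rightarrow> complex mat" where
  "cell_mat m n = incidence_mat m n * averaging_mat m n"

definition cell_eigenvalues :: "nat \<Rightarrow> nat \<Rightarrow> complex multiset" where
  "cell_eigenvalues m n = proots (char_poly (cell_mat m n))"

lemma incidence_mat_carrier: "incidence_mat m n \<in> carrier_mat (m ^ n) (vertex_count m n)"
  and averaging_mat_carrier: "averaging_mat m n \<in> carrier_mat (vertex_count m n) (m ^ n)"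
  and cell_mat_carrier: "cell_mat m n \<in> carrier_mat (m ^ n) (m ^ n)"
  by (auto simp: incidence_mat_def averaging_mat_def cell_mat_def)

lemma sum_of_bool_eq_mult:
  fixes g :: "nat \<Rightarrow> 'a :: semiring_1"
  shows "(\<Sum>k<c. of_bool (a = k) * g k) = (if a < c then g a else 0)"
proof -
  have "(\<Sum>k<c. of_bool (a = k) * g k) = (\<Sum>k<c. if a = k then g k else 0)"
    by (intro sum.cong) auto
  thus ?thesis by simp
qed

text \<open>Two new cells can share the \<open>m - 2\<close> further vertices of degree 1 (only if
  they are equal), the center of degree \<open>m\<close> (same parent), and the kept old vertex with
  its old degree. Each kind of shared vertex gives one term.\<close>

lemma cell_mat_Suc_index:
  assumes m: "m \<ge> 3" and q: "q < m ^ n * m" "q' < m ^ n * m"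
  defines "v \<equiv> \<lambda>q. cells m n ! (q div m) ! (q mod m)"
  shows "cell_mat m (Suc n) $$ (q, q') =
    of_nat (m - 2) * of_bool (q = q') + of_bool (q div m = q' div m) / of_nat m +
    of_bool (v q = v q') / of_nat (cell_degree m n (v q))"
proof -
  define N where "N = vertex_count m n"
  define c where "c = (\<lambda>k. N + k * (1 + m * (m - 2)))"
  define h :: "nat \<Rightarrow> complex" where "h x = of_bool (x \<in> set (cells m (Suc n) ! q)) *
    (of_bool (x \<in> set (cells m (Suc n) ! q')) / of_nat (cell_degree m (Suc n) x))" for x
  have old: "h x = of_bool (v q = x) * (of_bool (v q' = x) / of_nat (cell_degree m n x))" if "x < N" for x
    using that old_vertex_mem[OF m q(1)] old_vertex_mem[OF m q(2)] cell_degree_old[OF m]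
    by (simp add: h_def v_def N_def)
  have center: "h (c k) = of_bool (q div m = k) * (of_bool (q' div m = k) / of_nat m)" if "k < m ^ n" for k
    using center_mem[OF m q(1), of k] center_mem[OF m q(2), of k] cell_degree_center[OF m that]
    by (simp only: h_def c_def N_def)
  have further: "h (c k + (1 + (i * (m - 2) + j))) =
      of_bool (q div m = k) * (of_bool (q mod m = i) * of_bool (q' div m = k \<and> q' mod m = i))"
    if "k < m ^ n" "i < m" "j < m - 2" for k i j
    using further_mem[OF m q(1) that(2,3), of k] further_mem[OF m q(2) that(2,3), of k]
      cell_degree_further[OF m that]
    by (simp only: h_def c_def N_def) simp
  note b = flag_bounds[OF m q(1)] flag_bounds[OF m q(2)]
  have "cell_mat m (Suc n) $$ (q, q') = (\<Sum>x<vertex_count m (Suc n). h x)"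
    using q unfolding cell_mat_def incidence_mat_def averaging_mat_def mat_mult_mat h_def
    by (simp add: mult.commute)
  also have "\<dots> = (\<Sum>x<N. h x) + (\<Sum>k<m ^ n. h (c k) + (\<Sum>i<m. \<Sum>j<m - 2. h (c k + (1 + (i * (m - 2) + j)))))"
    unfolding c_def N_def by (rule sum_vertices_Suc[OF m])
  also have "(\<Sum>x<N. h x) = (\<Sum>x<N. of_bool (v q = x) * (of_bool (v q' = x) / of_nat (cell_degree m n x)))"
    by (intro sum.cong) (auto simp: old)
  also have "\<dots> = of_bool (v q = v q') / of_nat (cell_degree m n (v q))"
    using b by (subst sum_of_bool_eq_mult) (auto simp: v_def N_def)
  also have "(\<Sum>k<m ^ n. h (c k) + (\<Sum>i<m. \<Sum>j<m - 2. h (c k + (1 + (i * (m - 2) + j))))) =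
    (\<Sum>k<m ^ n. of_bool (q div m = k) * (of_bool (q' div m = k) / of_nat m +
      (\<Sum>i<m. of_bool (q mod m = i) * (of_nat (m - 2) * of_bool (q' div m = k \<and> q' mod m = i)))))"
  proof (intro sum.cong refl)
    fix k assume "k \<in> {..<m ^ n}"
    hence k: "k < m ^ n" by simp
    have "(\<Sum>i<m. \<Sum>j<m - 2. h (c k + (1 + (i * (m - 2) + j)))) =
      (\<Sum>i<m. \<Sum>j<m - 2. of_bool (q div m = k) * (of_bool (q mod m = i) * of_bool (q' div m = k \<and> q' mod m = i)))"
      by (intro sum.cong refl further) (use k in auto)
    also have "\<dots> = of_bool (q div m = k) *
        (\<Sum>i<m. of_bool (q mod m = i) * (of_nat (m - 2) * of_bool (q' div m = k \<and> q' mod m = i)))"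
      unfolding sum_distrib_left by (intro sum.cong) auto
    finally show "h (c k) + (\<Sum>i<m. \<Sum>j<m - 2. h (c k + (1 + (i * (m - 2) + j)))) =
      of_bool (q div m = k) * (of_bool (q' div m = k) / of_nat m +
      (\<Sum>i<m. of_bool (q mod m = i) * (of_nat (m - 2) * of_bool (q' div m = k \<and> q' mod m = i))))"
      by (simp only: center[OF k] distrib_left)
  qed
  also have "\<dots> = of_bool (q' div m = q div m) / of_nat m +
      of_nat (m - 2) * of_bool (q' div m = q div m \<and> q' mod m = q mod m)"
    unfolding sum_of_bool_eq_mult using b by simp
  also have "q' div m = q div m \<and> q' mod m = q mod m \<longleftrightarrow> q = q'"
    by (metis div_mult_mod_eq)
  finally show ?thesis by (simp add: eq_commute[of "q' div m"] add_ac)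
qed

text \<open>On the flags (cell, vertex of the cell) of level n, which index the cells of level n + 1, the
  next cell matrix is a multiple of the identity plus the projections onto the functions of the
  cell and onto the functions of the vertex. The angles between these two ranges are given by the
  cell matrix of level n.\<close>

lemma cell_mat_Suc_decomposition:
  assumes m: "m \<ge> 3"
  obtains U U' V W :: "complex mat"
  where "U \<in> carrier_mat (m ^ n * m) (m ^ n)" "U' \<in> carrier_mat (m ^ n) (m ^ n * m)"
    "V \<in> carrier_mat (m ^ n * m) (vertex_count m n)" "W \<in> carrier_mat (vertex_count m n) (m ^ n * m)"
    "U' * U = 1\<^sub>m (m ^ n)" "W * V = 1\<^sub>m (vertex_count m n)"
    "(U' * V) * (W * U) = (1 / of_nat m) \<cdot>\<^sub>m cell_mat m n"
    "cell_mat m (Suc n) = of_nat (m - 2) \<cdot>\<^sub>m 1\<^sub>m (m ^ n * m) + (U * U' + V * W)"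
proof -
  define F where "F = m ^ n * m"
  define N where "N = vertex_count m n"
  define v where "v = (\<lambda>q. cells m n ! (q div m) ! (q mod m))"
  \<comment> \<open>\<open>U\<close> and \<open>V\<close> lift functions of cells and of vertices to
    flags; \<open>U'\<close> and \<open>W\<close> average back over the flags of a cell and of a
    vertex. Averaging after lifting is the identity, so \<open>U * U'\<close> and
    \<open>V * W\<close> are projections.\<close>
  define U :: "complex mat" where "U = mat F (m ^ n) (\<lambda>(q, k). of_bool (q div m = k))"
  define U' :: "complex mat" where "U' = mat (m ^ n) F (\<lambda>(k, q). of_bool (q div m = k) / of_nat m)"
  define V :: "complex mat" where "V = mat F N (\<lambda>(q, x). of_bool (v q = x))"
  define W :: "complex mat" where "W = mat N F (\<lambda>(x, q). of_bool (v q = x) / of_nat (cell_degree m n x))"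
  have m0: "(of_nat m :: complex) \<noteq> 0" using m by auto
  have r0: "(of_nat (cell_degree m n x) :: complex) \<noteq> 0" if "x < N" for x
    using cell_degree_pos[OF m] that by (auto simp: N_def)
  \<comment> \<open>A cell and a vertex determine one flag if they are incident and none
    otherwise.\<close>
  have flag_sum: "(\<Sum>q<F. of_bool (q div m = k) * of_bool (v q = x)) = (of_bool (x \<in> set (cells m n ! k)) :: complex)"
    if "k < m ^ n" for k x
  proof -
    have "(\<Sum>q<F. of_bool (q div m = k) * of_bool (v q = x)) =
      (\<Sum>l<m ^ n. \<Sum>y\<in>set (cells m n ! l). of_bool (l = k) * of_bool (y = x) :: complex)"
      unfolding F_def v_def by (rule sum_flags_nth[OF m])
    also have "\<dots> = (\<Sum>l<m ^ n. of_bool (k = l) * of_bool (x \<in> set (cells m n ! l)))"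
    proof (intro sum.cong refl)
      fix l
      show "(\<Sum>y\<in>set (cells m n ! l). of_bool (l = k) * of_bool (y = x)) =
        (of_bool (k = l) * of_bool (x \<in> set (cells m n ! l)) :: complex)"
        by (cases "l = k") (simp_all add: of_bool_def)
    qed
    finally show ?thesis using that by (simp add: sum_of_bool_eq_mult)
  qed
  have U'U: "U' * U = 1\<^sub>m (m ^ n)"
  proof (rule eq_matI)
    fix k l assume "k < dim_row (1\<^sub>m (m ^ n))" "l < dim_col (1\<^sub>m (m ^ n))"
    hence kl: "k < m ^ n" "l < m ^ n" by simp_all
    have "(U' * U) $$ (k, l) = (\<Sum>q<m ^ n * m. of_bool (q div m = k) / of_nat m * of_bool (q div m = l))"
      using kl by (simp add: U_def U'_def mat_mult_mat F_def)
    also have "\<dots> = (\<Sum>j<m ^ n. \<Sum>i<m. of_bool (j = k) / of_nat m * of_bool (j = l))"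
      by (rule sum_div_mod)
    also have "\<dots> = (\<Sum>j<m ^ n. of_bool (k = j) * of_bool (k = l))"
      using m0 by (intro sum.cong) auto
    finally show "(U' * U) $$ (k, l) = 1\<^sub>m (m ^ n) $$ (k, l)"
      using kl by (simp add: sum_of_bool_eq_mult)
  qed (auto simp: U_def U'_def)
  have WV: "W * V = 1\<^sub>m N"
  proof (rule eq_matI)
    fix x y assume "x < dim_row (1\<^sub>m N)" "y < dim_col (1\<^sub>m N)"
    hence xy: "x < N" "y < N" by simp_all
    have "(W * V) $$ (x, y) = (\<Sum>q<F. of_bool (v q = x) / of_nat (cell_degree m n x) * of_bool (v q = y))"
      using xy by (simp add: V_def W_def mat_mult_mat)
    also have "\<dots> = of_bool (x = y) * (of_nat (\<Sum>q<F. of_bool (v q = x)) / of_nat (cell_degree m n x))"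
      unfolding of_nat_sum sum_divide_distrib sum_distrib_left by (intro sum.cong) auto
    also have "(\<Sum>q<F. of_bool (v q = x)) = cell_degree m n x"
      unfolding F_def v_def by (rule sum_flags_at_vertex[OF m])
    finally show "(W * V) $$ (x, y) = 1\<^sub>m N $$ (x, y)"
      using xy r0[OF xy(1)] by (cases "x = y") simp_all
  qed (auto simp: V_def W_def)
  have U'V: "U' * V = (1 / of_nat m) \<cdot>\<^sub>m incidence_mat m n"
  proof (rule eq_matI)
    fix k x assume "k < dim_row ((1 / of_nat m) \<cdot>\<^sub>m incidence_mat m n)"
      "x < dim_col ((1 / of_nat m) \<cdot>\<^sub>m incidence_mat m n)"
    hence kx: "k < m ^ n" "x < N" by (simp_all add: incidence_mat_def N_def)
    have "(U' * V) $$ (k, x) = (\<Sum>q<F. of_bool (q div m = k) * of_bool (v q = x)) / of_nat m"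
      unfolding sum_divide_distrib using kx by (simp add: U'_def V_def mat_mult_mat)
    also have "\<dots> = of_bool (x \<in> set (cells m n ! k)) / of_nat m"
      by (simp only: flag_sum[OF kx(1)])
    finally show "(U' * V) $$ (k, x) = ((1 / of_nat m) \<cdot>\<^sub>m incidence_mat m n) $$ (k, x)"
      using kx by (simp add: incidence_mat_def N_def)
  qed (auto simp: U'_def V_def incidence_mat_def N_def)
  have WU: "W * U = averaging_mat m n"
  proof (rule eq_matI)
    fix x k assume "x < dim_row (averaging_mat m n)" "k < dim_col (averaging_mat m n)"
    hence kx: "k < m ^ n" "x < N" by (simp_all add: averaging_mat_def N_def)
    have "(W * U) $$ (x, k) = (\<Sum>q<F. of_bool (q div m = k) * of_bool (v q = x)) / of_nat (cell_degree m n x)"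
      unfolding sum_divide_distrib using kx by (simp add: U_def W_def mat_mult_mat mult.commute)
    also have "\<dots> = of_bool (x \<in> set (cells m n ! k)) / of_nat (cell_degree m n x)"
      by (simp only: flag_sum[OF kx(1)])
    finally show "(W * U) $$ (x, k) = averaging_mat m n $$ (x, k)"
      using kx by (simp add: averaging_mat_def N_def)
  qed (auto simp: U_def W_def averaging_mat_def N_def)
  have eq: "cell_mat m (Suc n) = of_nat (m - 2) \<cdot>\<^sub>m 1\<^sub>m F + (U * U' + V * W)"
  proof (rule eq_matI)
    fix q q' assume "q < dim_row (of_nat (m - 2) \<cdot>\<^sub>m 1\<^sub>m F + (U * U' + V * W))"
      "q' < dim_col (of_nat (m - 2) \<cdot>\<^sub>m 1\<^sub>m F + (U * U' + V * W))"
    hence q: "q < F" "q' < F" by (simp_all add: V_def W_def)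
    note b = flag_bounds[OF m q(1)[unfolded F_def]] flag_bounds[OF m q(2)[unfolded F_def]]
    have "(U * U') $$ (q, q') = (\<Sum>k<m ^ n. of_bool (q div m = k) * (of_bool (q' div m = k) / of_nat m))"
      using q by (simp add: U_def U'_def mat_mult_mat)
    also have "\<dots> = of_bool (q' div m = q div m) / of_nat m"
      unfolding sum_of_bool_eq_mult using b by simp
    finally have UU': "(U * U') $$ (q, q') = of_bool (q div m = q' div m) / of_nat m"
      by (simp add: eq_commute[of "q div m"])
    have "(V * W) $$ (q, q') = (\<Sum>x<N. of_bool (v q = x) * (of_bool (v q' = x) / of_nat (cell_degree m n x)))"
      using q by (simp add: V_def W_def mat_mult_mat)
    also have "\<dots> = of_bool (v q' = v q) / of_nat (cell_degree m n (v q))"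
      unfolding sum_of_bool_eq_mult using b by (simp add: v_def N_def)
    finally have VW: "(V * W) $$ (q, q') = of_bool (v q = v q') / of_nat (cell_degree m n (v q))"
      by (simp add: eq_commute[of "v q"])
    have "(of_nat (m - 2) \<cdot>\<^sub>m 1\<^sub>m F + (U * U' + V * W)) $$ (q, q') =
      of_nat (m - 2) * of_bool (q = q') + ((U * U') $$ (q, q') + (V * W) $$ (q, q'))"
      using q by (simp add: U_def U'_def V_def W_def del: index_mult_mat(1))
    thus "cell_mat m (Suc n) $$ (q, q') = (of_nat (m - 2) \<cdot>\<^sub>m 1\<^sub>m F + (U * U' + V * W)) $$ (q, q')"
      unfolding UU' VW using cell_mat_Suc_index[OF m q[unfolded F_def]] by (simp add: v_def)
  qed (use cell_mat_carrier[of m "Suc n"] in \<open>auto simp: F_def V_def W_def mult.commute\<close>)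
  have prod: "(U' * V) * (W * U) = (1 / of_nat m) \<cdot>\<^sub>m cell_mat m n"
    unfolding U'V WU cell_mat_def
    by (rule mult_smult_assoc_mat[OF incidence_mat_carrier averaging_mat_carrier])
  show ?thesis
    by (rule that[of U U' V W]) (use U'U WV prod eq in \<open>auto simp: U_def U'_def V_def W_def F_def N_def\<close>)
qed

text \<open>Flags are the edges of the bipartite incidence graph of vertices and cells. It is a
  tree, so it has one edge fewer than nodes.\<close>

lemma size_flags:
  assumes "m \<ge> 3"
  shows "m ^ n * m + 1 = m ^ n + vertex_count m n" "vertex_count m n - m ^ n = (m - 2) * m ^ n + 1"
    "m ^ n \<le> vertex_count m n"
proof -
  obtain l where l: "m = 3 + l" using assms le_Suc_ex by blast
  show "m ^ n * m + 1 = m ^ n + vertex_count m n" "vertex_count m n - m ^ n = (m - 2) * m ^ n + 1"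
    "m ^ n \<le> vertex_count m n"
    using vertex_count_eq[of m n] assms by (simp_all add: l algebra_simps)
qed

lemma root_step_factorization:
  assumes "m > 0"
  shows "(t - of_nat (m - 1))\<^sup>2 - w / of_nat m = (t - root_step m True w) * (t - root_step m False w)"
proof -
  have "(csqrt (w / of_nat m))\<^sup>2 = w / of_nat m" by simp
  thus ?thesis unfolding root_step_def by (simp add: algebra_simps power2_eq_square)
qed

text \<open>In the determinant identity at \<open>s = t - (m - 2)\<close>, each factor (s - 1)^2 - w
  / m splits into two roots, and the power of \<open>s - 1\<close> gives the copies of
  \<open>m - 1\<close>. The lone factor \<open>s\<close> becomes the element \<open>m - 2\<close> on
  the left, the lower root for w = m; keeping it there avoids subtracting multisets.\<close>

lemma cell_eigenvalues_Suc:
  assumes m: "m \<ge> 3"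
  shows "add_mset (of_nat (m - 2)) (cell_eigenvalues m (Suc n)) =
    replicate_mset ((m - 2) * m ^ n + 1) (of_nat (m - 1)) +
    image_mset (root_step m True) (cell_eigenvalues m n) +
    image_mset (root_step m False) (cell_eigenvalues m n)"
proof (rule multiset_eq_if_prod_linear_eq)
  show "finite {of_nat (m - 2), of_nat (m - 1) :: complex}" by simp
next
  fix t :: complex assume t: "t \<notin> {of_nat (m - 2), of_nat (m - 1)}"
  define s where "s = t - of_nat (m - 2)"
  define F where "F = m ^ n * m"
  have m1: "(of_nat (m - 1) :: complex) = of_nat (m - 2) + 1" using m by (simp add: of_nat_diff)
  have s: "s \<noteq> 0" "s \<noteq> 1" "s - 1 = t - of_nat (m - 1)" using t unfolding m1 s_def by (auto simp: diff_eq_eq add.commute)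
  obtain U U' V W :: "complex mat" where
    dec: "U \<in> carrier_mat F (m ^ n)" "U' \<in> carrier_mat (m ^ n) F"
    "V \<in> carrier_mat F (vertex_count m n)" "W \<in> carrier_mat (vertex_count m n) F"
    "U' * U = 1\<^sub>m (m ^ n)" "W * V = 1\<^sub>m (vertex_count m n)"
    and prod: "(U' * V) * (W * U) = (1 / of_nat m) \<cdot>\<^sub>m cell_mat m n"
    and eq: "cell_mat m (Suc n) = of_nat (m - 2) \<cdot>\<^sub>m 1\<^sub>m F + (U * U' + V * W)"
    using cell_mat_Suc_decomposition[OF m] unfolding F_def by metis
  have car: "cell_mat m (Suc n) \<in> carrier_mat F F"
    using cell_mat_carrier[of m "Suc n"] by (simp add: F_def mult.commute)
  have UV: "U * U' + V * W \<in> carrier_mat F F" using dec by auto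
  have "(\<Prod>w\<in>#cell_eigenvalues m (Suc n). t - w) = det (t \<cdot>\<^sub>m 1\<^sub>m F - 1 \<cdot>\<^sub>m cell_mat m (Suc n))"
    using det_smult_one_minus_smult[OF car, of t 1] by (simp add: cell_eigenvalues_def)
  also have "t \<cdot>\<^sub>m 1\<^sub>m F - 1 \<cdot>\<^sub>m cell_mat m (Suc n) = s \<cdot>\<^sub>m 1\<^sub>m F - (U * U' + V * W)"
  proof -
    have "t \<cdot>\<^sub>m 1\<^sub>m F - 1 \<cdot>\<^sub>m (of_nat (m - 2) \<cdot>\<^sub>m 1\<^sub>m F + T) = s \<cdot>\<^sub>m 1\<^sub>m F - T"
      if "T \<in> carrier_mat F F" for T
      using that by (intro eq_matI) (auto simp: s_def)
    thus ?thesis unfolding eq using UV by blast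
  qed
  finally have "s * (\<Prod>w\<in>#cell_eigenvalues m (Suc n). t - w) =
      (s - 1) ^ (vertex_count m n - m ^ n) * det ((s - 1)\<^sup>2 \<cdot>\<^sub>m 1\<^sub>m (m ^ n) - (1 / of_nat m) \<cdot>\<^sub>m cell_mat m n)"
    using det_smult_one_minus_sum_projections[OF dec _ _ s(1,2)] size_flags[OF m, of n] prod
    by (simp add: F_def)
  also have "det ((s - 1)\<^sup>2 \<cdot>\<^sub>m 1\<^sub>m (m ^ n) - (1 / of_nat m) \<cdot>\<^sub>m cell_mat m n) =
      (\<Prod>w\<in>#cell_eigenvalues m n. (s - 1)\<^sup>2 - 1 / of_nat m * w)"
    unfolding cell_eigenvalues_def by (rule det_smult_one_minus_smult[OF cell_mat_carrier])
  also have "\<dots> = (\<Prod>w\<in>#cell_eigenvalues m n. (t - root_step m True w) * (t - root_step m False w))"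
    using m by (simp add: s(3) flip: root_step_factorization)
  finally show "(\<Prod>a\<in>#add_mset (of_nat (m - 2)) (cell_eigenvalues m (Suc n)). t - a) =
    (\<Prod>b\<in>#replicate_mset ((m - 2) * m ^ n + 1) (of_nat (m - 1)) +
    image_mset (root_step m True) (cell_eigenvalues m n) +
    image_mset (root_step m False) (cell_eigenvalues m n). t - b)"
    unfolding size_flags(2)[OF m] s(3)
    by (simp add: prod_mset.distrib image_mset.compositionality o_def s_def mult_ac)
qed

lemma cell_eigenvalues_0:
  assumes "m \<ge> 3"
  shows "cell_eigenvalues m 0 = {#of_nat m#}"
proof (rule multiset_eq_if_prod_linear_eq[of "{}"])
  fix t :: complex
  have car: "cell_mat m 0 \<in> carrier_mat 1 1" using cell_mat_carrier[of m 0] by simp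
  have "cell_mat m 0 $$ (0, 0) = of_nat m"
    by (simp add: cell_mat_def incidence_mat_def averaging_mat_def mat_mult_mat cell_degree_def
        lessThan_atLeast0)
  hence "det (t \<cdot>\<^sub>m 1\<^sub>m 1 - 1 \<cdot>\<^sub>m cell_mat m 0) = t - of_nat m"
    using car by (subst det_single) auto
  thus "(\<Prod>w\<in>#cell_eigenvalues m 0. t - w) = (\<Prod>w\<in>#{#of_nat m#}. t - w)"
    using det_smult_one_minus_smult[OF car, of t 1] by (simp add: cell_eigenvalues_def)
qed simp

text \<open>The unit disc around \<open>m - 1\<close> is stable: its points have modulus at most
  \<open>m\<close>, so the root of \<open>w / m\<close> has modulus at most 1.\<close>

lemma cell_eigenvalues_near:
  assumes m: "m \<ge> 3" and "w \<in># cell_eigenvalues m n"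
  shows "cmod (w - of_nat (m - 1)) \<le> 1"
  using assms(2)
proof (induction n arbitrary: w)
  case 0
  thus ?case using m by (simp add: cell_eigenvalues_0 of_nat_diff)
next
  case (Suc n)
  have root: "cmod (root_step m b u - of_nat (m - 1)) \<le> 1" if "u \<in># cell_eigenvalues m n" for u b
  proof -
    have "cmod u \<le> cmod (u - of_nat (m - 1)) + cmod (of_nat (m - 1))"
      using norm_triangle_ineq[of "u - of_nat (m - 1)" "of_nat (m - 1)"] by simp
    moreover have "real (m - 1) = real m - 1" using m by (simp add: of_nat_diff)
    ultimately have "cmod u \<le> m" using Suc.IH[OF that] unfolding norm_of_nat by linarith
    hence "cmod (u / of_nat m) \<le> 1" using m by (simp add: norm_divide)
    moreover have "cmod (csqrt (u / of_nat m)) ^ 2 = cmod (u / of_nat m)"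
      by (simp flip: norm_power)
    ultimately have "cmod (csqrt (u / of_nat m)) \<le> 1"
      by (metis abs_norm_cancel abs_square_le_1)
    thus ?thesis by (simp add: root_step_def)
  qed
  have "w \<in># add_mset (of_nat (m - 2)) (cell_eigenvalues m (Suc n))" using Suc.prems by simp
  thus ?case unfolding cell_eigenvalues_Suc[OF m] using root by (auto split: if_splits)
qed

section \<open>From cell eigenvalues to the spectrum of the Laplacian\<close>

lemma adjacent_iff_cell:
  "adjacent m n x y \<longleftrightarrow> x \<noteq> y \<and> (\<exists>k<m ^ n. x \<in> set (cells m n ! k) \<and> y \<in> set (cells m n ! k))"
proof -
  have "set (cells m n) = (!) (cells m n) ` {..<m ^ n}"
    by (force simp: set_conv_nth length_cells)
  thus ?thesis unfolding adjacent_def by auto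
qed

text \<open>The cells through \<open>x\<close> meet pairwise only in \<open>x\<close>, so each
  contributes its own \<open>m - 1\<close> neighbours.\<close>

lemma vertex_degree_eq:
  assumes m: "m \<ge> 3" and x: "x < vertex_count m n"
  shows "vertex_degree m n x = (m - 1) * cell_degree m n x"
proof -
  define K where "K = {k. k < m ^ n \<and> x \<in> set (cells m n ! k)}"
  have "{y \<in> {..<vertex_count m n}. adjacent m n x y} = (\<Union>k\<in>K. set (cells m n ! k) - {x})"
  proof (rule Set.set_eqI)
    fix y
    have "y < vertex_count m n" if "k < m ^ n" "y \<in> set (cells m n ! k)" for k
      using cells_wf(3)[of m k n y] that m by simp
    thus "y \<in> {y \<in> {..<vertex_count m n}. adjacent m n x y} \<longleftrightarrow> y \<in> (\<Union>k\<in>K. set (cells m n ! k) - {x})"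
      by (auto simp: adjacent_iff_cell K_def)
  qed
  hence "vertex_degree m n x = card (\<Union>k\<in>K. set (cells m n ! k) - {x})"
    by (simp add: vertex_degree_def)
  also have "\<dots> = (\<Sum>k\<in>K. card (set (cells m n ! k) - {x}))"
  proof (rule card_UN_disjoint)
    show "\<forall>k\<in>K. \<forall>l\<in>K. k \<noteq> l \<longrightarrow> (set (cells m n ! k) - {x}) \<inter> (set (cells m n ! l) - {x}) = {}"
    proof (intro ballI impI)
      fix k l assume "k \<in> K" "l \<in> K" "k \<noteq> l"
      hence "y = x" if "y \<in> set (cells m n ! k)" "y \<in> set (cells m n ! l)" for y
        using common_cell_unique[OF m, of k n l x y] that by (auto simp: K_def)
      thus "(set (cells m n ! k) - {x}) \<inter> (set (cells m n ! l) - {x}) = {}" by blast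
    qed
  qed (auto simp: K_def)
  also have "\<dots> = (\<Sum>k\<in>K. m - 1)"
  proof (rule sum.cong[OF refl])
    fix k assume "k \<in> K"
    thus "card (set (cells m n ! k) - {x}) = m - 1"
      using cells_wf(1,2)[of m k n] m by (simp add: K_def distinct_card)
  qed
  also have "\<dots> = (m - 1) * cell_degree m n x"
    by (simp add: cell_degree_def K_def sum.If_cases of_bool_def Int_def)
  finally show ?thesis .
qed

lemma averaging_mult_incidence_index:
  assumes m: "m \<ge> 3" and xy: "x < vertex_count m n" "y < vertex_count m n"
  shows "(averaging_mat m n * incidence_mat m n) $$ (x, y) =
    (if x = y then 1 else of_bool (adjacent m n x y) / of_nat (cell_degree m n x))"
proof -
  let ?r = "of_nat (cell_degree m n x) :: complex"
  have r: "?r \<noteq> 0" using cell_degree_pos[OF m xy(1)] by simp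
  define S :: complex where "S = (\<Sum>k<m ^ n. of_bool (x \<in> set (cells m n ! k) \<and> y \<in> set (cells m n ! k)))"
  have "(averaging_mat m n * incidence_mat m n) $$ (x, y) = S / ?r"
    using xy unfolding S_def sum_divide_distrib
    by (auto simp: averaging_mat_def incidence_mat_def mat_mult_mat intro!: sum.cong)
  moreover have "S = ?r" if "x = y" using that by (simp add: S_def cell_degree_def)
  moreover have "S = of_bool (adjacent m n x y)" if "x \<noteq> y"
  proof (cases "adjacent m n x y")
    case True
    then obtain k where k: "k < m ^ n" "x \<in> set (cells m n ! k)" "y \<in> set (cells m n ! k)"
      using adjacent_iff_cell by blast
    have "S = (\<Sum>l<m ^ n. of_bool (k = l) * 1)"
      unfolding S_def
    proof (intro sum.cong refl)
      fix l assume "l \<in> {..<m ^ n}"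
      hence "x \<in> set (cells m n ! l) \<and> y \<in> set (cells m n ! l) \<longleftrightarrow> k = l"
        using common_cell_unique[OF m k(1), of l x y] that k by auto
      thus "of_bool (x \<in> set (cells m n ! l) \<and> y \<in> set (cells m n ! l)) = (of_bool (k = l) * 1 :: complex)"
        by simp
    qed
    thus ?thesis using k True by (subst (asm) sum_of_bool_eq_mult) simp
  next
    case False
    hence "\<not> (x \<in> set (cells m n ! l) \<and> y \<in> set (cells m n ! l))" if "l < m ^ n" for l
      using that \<open>x \<noteq> y\<close> by (auto simp: adjacent_iff_cell)
    hence "S = 0" unfolding S_def by (intro sum.neutral) simp
    thus ?thesis using False by simp
  qed
  ultimately show ?thesis using r by auto
qed

text \<open>With e = 1 / (m - 1), the Laplacian is (1 + e) I - e R^-1 B B^T, because the product has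
  diagonal 1 and off-diagonal entries 1 over the cell degree. Exchanging the factors leaves the cell
  matrix, and the excess of vertices over cells is filled by the eigenvalue 1 + e = m / (m -
  1).\<close>

lemma proots_laplacian:
  assumes m: "m \<ge> 3"
  shows "proots (char_poly (laplacian m n)) =
    replicate_mset ((m - 2) * m ^ n + 1) (of_nat m / of_nat (m - 1)) +
    image_mset (\<lambda>w. (of_nat m - w) / of_nat (m - 1)) (cell_eigenvalues m n)"
proof (rule multiset_eq_if_prod_linear_eq)
  let ?a = "of_nat m / of_nat (m - 1) :: complex"
  define e :: complex where "e = 1 / of_nat (m - 1)"
  define N where "N = vertex_count m n"
  show "finite {?a}" by simp
  fix z assume "z \<notin> {?a}"
  define s where "s = z - ?a"
  have s: "s \<noteq> 0" using \<open>z \<notin> {?a}\<close> by (simp add: s_def)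
  have m1: "(of_nat (m - 1) :: complex) \<noteq> 0" using m by simp
  have a: "?a = 1 + e"
    using m m1 by (simp add: e_def field_simps of_nat_diff)
  have s_eq: "s = z - 1 - e" using a by (simp add: s_def)
  define X where "X = (- e) \<cdot>\<^sub>m averaging_mat m n"
  have X: "X \<in> carrier_mat N (m ^ n)" using averaging_mat_carrier by (simp add: X_def N_def)
  have inc: "incidence_mat m n \<in> carrier_mat (m ^ n) N" using incidence_mat_carrier by (simp add: N_def)
  have avg: "averaging_mat m n \<in> carrier_mat N (m ^ n)" using averaging_mat_carrier by (simp add: N_def)
  have XI: "X * incidence_mat m n = (- e) \<cdot>\<^sub>m (averaging_mat m n * incidence_mat m n)"
    unfolding X_def by (rule mult_smult_assoc_mat[OF avg inc])
  have IX: "incidence_mat m n * X = (- e) \<cdot>\<^sub>m cell_mat m n"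
    unfolding X_def cell_mat_def by (rule mult_smult_distrib[OF inc avg])
  have lap: "z \<cdot>\<^sub>m 1\<^sub>m N - 1 \<cdot>\<^sub>m laplacian m n = s \<cdot>\<^sub>m 1\<^sub>m N - X * incidence_mat m n"
    unfolding XI
  proof (rule eq_matI)
    fix x y assume "x < dim_row (s \<cdot>\<^sub>m 1\<^sub>m N - (- e) \<cdot>\<^sub>m (averaging_mat m n * incidence_mat m n))"
      "y < dim_col (s \<cdot>\<^sub>m 1\<^sub>m N - (- e) \<cdot>\<^sub>m (averaging_mat m n * incidence_mat m n))"
    hence xy: "x < N" "y < N" using avg inc by simp_all
    have "(s \<cdot>\<^sub>m 1\<^sub>m N - (- e) \<cdot>\<^sub>m (averaging_mat m n * incidence_mat m n)) $$ (x, y) =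
      s * of_bool (x = y) + e * (averaging_mat m n * incidence_mat m n) $$ (x, y)"
      using xy avg inc by (simp del: index_mult_mat(1))
    also have "\<dots> = s * of_bool (x = y) +
        e * (if x = y then 1 else of_bool (adjacent m n x y) / of_nat (cell_degree m n x))"
      using averaging_mult_incidence_index[OF m] xy by (simp only: N_def)
    also have "\<dots> = (z \<cdot>\<^sub>m 1\<^sub>m N - 1 \<cdot>\<^sub>m laplacian m n) $$ (x, y)"
      using xy vertex_degree_eq[OF m, of x n] by (simp add: laplacian_def N_def s_eq e_def)
    finally show "(z \<cdot>\<^sub>m 1\<^sub>m N - 1 \<cdot>\<^sub>m laplacian m n) $$ (x, y) =
      (s \<cdot>\<^sub>m 1\<^sub>m N - (- e) \<cdot>\<^sub>m (averaging_mat m n * incidence_mat m n)) $$ (x, y)" by simp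
  qed (use avg inc in \<open>auto simp: laplacian_def N_def\<close>)
  have "s ^ m ^ n * (\<Prod>w\<in>#proots (char_poly (laplacian m n)). z - w) =
      s ^ m ^ n * det (s \<cdot>\<^sub>m 1\<^sub>m N - X * incidence_mat m n)"
    unfolding lap[symmetric] unfolding N_def
    by (simp only: det_smult_one_minus_smult[OF laplacian_carrier] mult_1)
  also have "\<dots> = s ^ N * det (s \<cdot>\<^sub>m 1\<^sub>m (m ^ n) - (- e) \<cdot>\<^sub>m cell_mat m n)"
    using det_smult_one_minus_mult_commute[OF X inc] by (simp add: IX)
  also have "det (s \<cdot>\<^sub>m 1\<^sub>m (m ^ n) - (- e) \<cdot>\<^sub>m cell_mat m n) = (\<Prod>w\<in>#cell_eigenvalues m n. s - (- e) * w)"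
    unfolding cell_eigenvalues_def by (rule det_smult_one_minus_smult[OF cell_mat_carrier])
  also have "s ^ N = s ^ m ^ n * s ^ ((m - 2) * m ^ n + 1)"
    using size_flags[OF m, of n] by (metis N_def le_add_diff_inverse power_add)
  finally have "(\<Prod>w\<in>#proots (char_poly (laplacian m n)). z - w) =
      s ^ ((m - 2) * m ^ n + 1) * (\<Prod>w\<in>#cell_eigenvalues m n. s - (- e) * w)"
    using s by simp
  also have "(\<lambda>w. s - (- e) * w) = (\<lambda>w. z - (of_nat m - w) / of_nat (m - 1))"
    by (auto simp: fun_eq_iff s_def e_def diff_divide_distrib)
  finally show "(\<Prod>w\<in>#proots (char_poly (laplacian m n)). z - w) =
    (\<Prod>w\<in>#replicate_mset ((m - 2) * m ^ n + 1) ?a +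
    image_mset (\<lambda>w. (of_nat m - w) / of_nat (m - 1)) (cell_eigenvalues m n). z - w)"
    by (simp add: image_mset.compositionality o_def s_def)
qed

section \<open>Convergence\<close>

lemma limit_spectrum_near:
  assumes m: "m \<ge> 3" and z: "z \<in> limit_spectrum m"
  shows "z = of_nat m / of_nat (m - 1) \<or> cmod z \<le> 2 / real (m - 1)"
proof -
  obtain n where "z \<in># proots (char_poly (laplacian m n))"
    using z by (auto simp: limit_spectrum_def spectrum_laplacian simp del: set_count_proots)
  hence "z = of_nat m / of_nat (m - 1) \<or>
    (\<exists>w \<in># cell_eigenvalues m n. z = (of_nat m - w) / of_nat (m - 1))"
    unfolding proots_laplacian[OF m] by (auto split: if_splits)
  thus ?thesis
  proof
    assume "\<exists>w \<in># cell_eigenvalues m n. z = (of_nat m - w) / of_nat (m - 1)"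
    then obtain w where w: "w \<in># cell_eigenvalues m n" "z = (of_nat m - w) / of_nat (m - 1)" by blast
    \<comment> \<open>The constant 2 is the modulus 1 of the first term plus the radius 1 of the
      disc of cell eigenvalues.\<close>
    have eq: "of_nat m - w = 1 - (w - of_nat (m - 1))" using m by (simp add: of_nat_diff)
    have "cmod (of_nat m - w) \<le> 2"
      unfolding eq using norm_triangle_ineq4[of 1 "w - of_nat (m - 1)"] cell_eigenvalues_near[OF m w(1)] by simp
    thus ?thesis unfolding w(2) by (simp add: norm_divide divide_right_mono del: of_nat_diff)
  qed simp
qed

text \<open>Level 0 attains both values: its only cell eigenvalue \<open>m\<close> gives 0, and the
  other value occurs there with multiplicity \<open>m - 1\<close>.\<close>

lemma limit_spectrum_mem:
  assumes m: "m \<ge> 3"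
  shows "0 \<in> limit_spectrum m" "of_nat m / of_nat (m - 1) \<in> limit_spectrum m"
proof -
  have "set_mset (proots (char_poly (laplacian m 0))) \<subseteq> limit_spectrum m"
    unfolding limit_spectrum_def spectrum_laplacian by blast
  moreover have "{0, of_nat m / of_nat (m - 1)} \<subseteq> set_mset (proots (char_poly (laplacian m 0)))"
    unfolding proots_laplacian[OF m] cell_eigenvalues_0[OF m] by simp
  ultimately show "0 \<in> limit_spectrum m" "of_nat m / of_nat (m - 1) \<in> limit_spectrum m" by blast+
qed

lemma dist_top_eigenvalue:
  assumes "m \<ge> 3"
  shows "dist (of_nat m / of_nat (m - 1)) (1 :: complex) = 1 / real (m - 1)"
proof -
  have "of_nat m / of_nat (m - 1) - 1 = (1 / of_nat (m - 1) :: complex)"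
    using assms by (simp add: field_simps of_nat_diff)
  thus ?thesis by (simp only: dist_norm norm_divide norm_one norm_of_nat)
qed

lemma hausdorff_distance_limit_spectrum_le:
  assumes m: "m \<ge> 3"
  shows "hausdorff_distance (limit_spectrum m) {0, 1} \<le> ennreal (2 / real (m - 1))"
proof -
  let ?a = "of_nat m / of_nat (m - 1) :: complex"
  have a: "dist ?a 1 \<le> 2 / real (m - 1)" "dist 1 ?a \<le> 2 / real (m - 1)"
    using dist_top_eigenvalue[OF m] by (simp_all add: dist_commute divide_right_mono)
  have "(INF y\<in>{0, 1}. ennreal (dist x y)) \<le> ennreal (2 / real (m - 1))" if "x \<in> limit_spectrum m" for x
    using limit_spectrum_near[OF m that]
  proof
    assume "x = ?a"
    thus ?thesis using a by (intro INF_lower2[of 1] ennreal_leI) auto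
  next
    assume "cmod x \<le> 2 / real (m - 1)"
    thus ?thesis by (intro INF_lower2[of 0] ennreal_leI) auto
  qed
  moreover have "(INF x\<in>limit_spectrum m. ennreal (dist x 0)) \<le> ennreal (2 / real (m - 1))"
    using limit_spectrum_mem(1)[OF m] by (intro INF_lower2[of 0]) auto
  moreover have "(INF x\<in>limit_spectrum m. ennreal (dist x 1)) \<le> ennreal (2 / real (m - 1))"
    using limit_spectrum_mem(2)[OF m] a by (intro INF_lower2[of ?a] ennreal_leI) auto
  ultimately show ?thesis
    unfolding hausdorff_distance_def by (intro max.boundedI SUP_least) (auto simp: dist_commute)
qed

text \<open>The coin has the limiting share of \<open>m / (m - 1)\<close> at level \<open>n\<close>,
  which is \<open>((m - 2) * m ^ n + 1) / ((m - 1) * m ^ n + 1)\<close>. The other branch carries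
  the cell law along the affine map from cell to Laplacian eigenvalues.\<close>

definition spectral_limit_pmf :: "nat \<Rightarrow> complex pmf" where
  "spectral_limit_pmf m = bind_pmf (bernoulli_pmf ((real m - 2) / (real m - 1)))
     (\<lambda>b. if b then return_pmf (of_nat m / of_nat (m - 1))
          else map_pmf (\<lambda>w. (of_nat m - w) / of_nat (m - 1)) (cell_limit_pmf m))"

text \<open>A pmf measures all subsets of the plane; transport along the identity restricts it to
  the Borel sets.\<close>

definition spectral_limit :: "nat \<Rightarrow> complex measure" where
  "spectral_limit m = distr (measure_pmf (spectral_limit_pmf m)) borel (\<lambda>z. z)"

lemma finite_borel_spectral_limit: "finite_borel_measure (spectral_limit m)"
  unfolding finite_borel_measure_def spectral_limit_def
  by (auto intro!: measure_pmf.finite_measure_distr)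

lemma integral_spectral_limit:
  fixes f :: "complex \<Rightarrow> real"
  assumes m: "m \<ge> 3" and f: "f \<in> borel_measurable borel" "\<And>x. \<bar>f x\<bar> \<le> B"
  shows "integral\<^sup>L (spectral_limit m) f =
    (real m - 2) / (real m - 1) * f (of_nat m / of_nat (m - 1)) +
    measure_pmf.expectation (cell_limit_pmf m) (\<lambda>w. f ((of_nat m - w) / of_nat (m - 1))) / (real m - 1)"
proof -
  have p: "0 \<le> (real m - 2) / (real m - 1)" "(real m - 2) / (real m - 1) \<le> 1"
    "1 - (real m - 2) / (real m - 1) = 1 / (real m - 1)"
    using m by (auto simp: field_simps)
  have "integral\<^sup>L (spectral_limit m) f = measure_pmf.expectation (spectral_limit_pmf m) f"
    unfolding spectral_limit_def using f by (subst integral_distr) auto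
  also have "\<dots> = (real m - 2) / (real m - 1) * f (of_nat m / of_nat (m - 1)) +
    measure_pmf.expectation (cell_limit_pmf m) (\<lambda>w. f ((of_nat m - w) / of_nat (m - 1))) *
      (1 - (real m - 2) / (real m - 1))"
    unfolding spectral_limit_pmf_def by (subst expectation_bind_pmf[OF f(2)]) (use p in simp)
  finally show ?thesis unfolding p(3) by simp
qed

lemma weakly_converges_eigenvalue_measure:
  assumes m: "m \<ge> 3"
  shows "weakly_converges (\<lambda>n. eigenvalue_measure m n) (spectral_limit m)"
  unfolding weakly_converges_def
proof (intro conjI allI impI)
  fix f :: "complex \<Rightarrow> real"
  assume cont: "continuous_on UNIV f" and "bounded (range f)"
  then obtain B where B: "\<And>x. \<bar>f x\<bar> \<le> B" by (auto simp: bounded_iff)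
  have meas: "f \<in> borel_measurable borel" by (rule borel_measurable_continuous_onI[OF cont])
  define g where "g = (\<lambda>w. f ((of_nat m - w) / of_nat (m - 1)))"
  define A where "A = (\<lambda>n. (\<Sum>w\<in>#cell_eigenvalues m n. g w) / real m ^ n)"
  let ?a = "of_nat m / of_nat (m - 1) :: complex"
  have A: "A \<longlonglongrightarrow> measure_pmf.expectation (cell_limit_pmf m) g"
    unfolding A_def
    by (rule root_average_tendsto[where B = B, OF m cell_eigenvalues_0[OF m] cell_eigenvalues_Suc[OF m]])
       (simp add: g_def B)
  have inv: "(\<lambda>n. (1 / real m) ^ n) \<longlonglongrightarrow> 0"
    using m by (intro LIMSEQ_realpow_zero) auto
  \<comment> \<open>Numerator and denominator are divided by \<open>m ^ n\<close>; the isolated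
    \<open>+ 1\<close> in both counts turns into the null sequence
    \<open>(1 / m) ^ n\<close>.\<close>
  have eq: "integral\<^sup>L (eigenvalue_measure m n) f =
      ((real m - 2 + (1 / real m) ^ n) * f ?a + A n) / (real m - 1 + (1 / real m) ^ n)" for n
  proof -
    define M where "M = real m ^ n"
    have M: "M > 0" using m by (simp add: M_def)
    have "integral\<^sup>L (eigenvalue_measure m n) f =
      (((real m - 2) * M + 1) * f ?a + (\<Sum>w\<in>#cell_eigenvalues m n. g w)) / ((real m - 1) * M + 1)"
      unfolding integral_eigenvalue_measure[OF meas] proots_laplacian[OF m] g_def M_def
      using m by (simp add: vertex_count_eq of_nat_diff image_mset.compositionality o_def algebra_simps)
    also have "\<dots> = (((real m - 2) * M + 1) * f ?a + A n * M) / ((real m - 1) * M + 1)"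
      using M by (simp add: A_def M_def)
    also have "(real m - 2) * M + 1 = (real m - 2 + 1 / M) * M"
      using M by (simp add: field_simps)
    also have "(real m - 1) * M + 1 = (real m - 1 + 1 / M) * M"
      using M by (simp add: field_simps)
    also have "(real m - 2 + 1 / M) * M * f ?a + A n * M = ((real m - 2 + 1 / M) * f ?a + A n) * M"
      by (simp add: algebra_simps)
    also have "\<dots> / ((real m - 1 + 1 / M) * M) = ((real m - 2 + 1 / M) * f ?a + A n) / (real m - 1 + 1 / M)"
      using M by simp
    finally show ?thesis by (simp add: M_def power_divide)
  qed
  have "(\<lambda>n. integral\<^sup>L (eigenvalue_measure m n) f) \<longlonglongrightarrow>
      ((real m - 2 + 0) * f ?a + measure_pmf.expectation (cell_limit_pmf m) g) / (real m - 1 + 0)"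
    unfolding eq using m by (intro tendsto_intros A inv) auto
  thus "(\<lambda>n. integral\<^sup>L (eigenvalue_measure m n) f) \<longlonglongrightarrow> integral\<^sup>L (spectral_limit m) f"
    unfolding integral_spectral_limit[OF m meas B] by (simp add: g_def add_divide_distrib)
qed (auto simp: finite_borel_eigenvalue_measure finite_borel_spectral_limit)

text \<open>The cluster near 0 has total mass \<open>1 / (m - 1)\<close>, so it disappears weakly
  although the Hausdorff limit keeps the point 0. Boundedness of \<open>f\<close> controls this
  part, and continuity at 1 the remaining atom.\<close>

lemma weakly_converges_spectral_limit: "weakly_converges spectral_limit (return borel 1)"
  unfolding weakly_converges_def
proof (intro conjI allI impI)
  show "finite_borel_measure (return borel (1 :: complex))"
    unfolding finite_borel_measure_def
    by (auto intro!: prob_space.finite_measure prob_space_return)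
next
  fix f :: "complex \<Rightarrow> real"
  assume cont: "continuous_on UNIV f" and "bounded (range f)"
  then obtain B where B: "\<And>x. \<bar>f x\<bar> \<le> B" by (auto simp: bounded_iff)
  have meas: "f \<in> borel_measurable borel" by (rule borel_measurable_continuous_onI[OF cont])
  define E where "E = (\<lambda>m. measure_pmf.expectation (cell_limit_pmf m) (\<lambda>w. f ((of_nat m - w) / of_nat (m - 1))))"
  have "(\<lambda>m. (of_nat m / of_nat (m - 1) :: complex)) \<longlonglongrightarrow> 1"
  proof (rule tendsto_dist_iff[THEN iffD2], rule Lim_transform_eventually)
    show "(\<lambda>m. 1 / (real m - 1)) \<longlonglongrightarrow> 0" by real_asymp
    show "\<forall>\<^sub>F m in sequentially. 1 / (real m - 1) = dist (of_nat m / of_nat (m - 1)) (1 :: complex)"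
      using eventually_ge_at_top[of "3 :: nat"]
      by eventually_elim (simp only: dist_top_eigenvalue, simp add: of_nat_diff)
  qed
  moreover have "isCont f 1" using cont by (simp add: continuous_on_eq_continuous_at)
  ultimately have f1: "(\<lambda>m. f (of_nat m / of_nat (m - 1))) \<longlonglongrightarrow> f 1"
    by (rule isCont_tendsto_compose[rotated])
  have coeff: "(\<lambda>m. (real m - 2) / (real m - 1)) \<longlonglongrightarrow> 1" by real_asymp
  have null: "(\<lambda>m. E m / (real m - 1)) \<longlonglongrightarrow> 0"
  proof (rule Lim_null_comparison)
    show "(\<lambda>m. B / (real m - 1)) \<longlonglongrightarrow> 0" by real_asymp
    show "\<forall>\<^sub>F m in sequentially. norm (E m / (real m - 1)) \<le> B / (real m - 1)"
      using eventually_ge_at_top[of "3 :: nat"]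
    proof eventually_elim
      case (elim m)
      have "\<bar>E m\<bar> \<le> B" unfolding E_def by (intro abs_expectation_le B)
      thus ?case using elim by (simp add: divide_right_mono)
    qed
  qed
  have "(\<lambda>m. (real m - 2) / (real m - 1) * f (of_nat m / of_nat (m - 1)) + E m / (real m - 1))
      \<longlonglongrightarrow> 1 * f 1 + 0"
    by (intro tendsto_intros coeff f1 null)
  moreover have "\<forall>\<^sub>F m in sequentially.
      (real m - 2) / (real m - 1) * f (of_nat m / of_nat (m - 1)) + E m / (real m - 1) =
      integral\<^sup>L (spectral_limit m) f"
    using eventually_ge_at_top[of "3 :: nat"]
    by eventually_elim (simp only: integral_spectral_limit[OF _ meas B] E_def)
  ultimately have "(\<lambda>m. integral\<^sup>L (spectral_limit m) f) \<longlonglongrightarrow> 1 * f 1 + 0"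
    by (rule Lim_transform_eventually)
  thus "(\<lambda>m. integral\<^sup>L (spectral_limit m) f) \<longlonglongrightarrow> integral\<^sup>L (return borel 1) f"
    using meas by (simp add: integral_return)
qed (simp add: finite_borel_spectral_limit)

theorem theorem6p1:
  shows "((\<lambda>m. hausdorff_distance (limit_spectrum m) {0, 1}) \<longlonglongrightarrow> 0) \<and>
    (\<exists>\<kappa> :: nat \<Rightarrow> complex measure.
       (\<forall>m\<ge>3. weakly_converges (\<lambda>n. eigenvalue_measure m n) (\<kappa> m)) \<and>
       weakly_converges \<kappa> (return borel 1))"
proof (intro conjI exI[of _ spectral_limit] allI impI)
  have "(\<lambda>m. 2 / real (m - 1)) \<longlonglongrightarrow> 0" by real_asymp
  from tendsto_ennrealI[OF this]
  have upper: "(\<lambda>m. ennreal (2 / real (m - 1))) \<longlonglongrightarrow> 0" by simp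
  show "(\<lambda>m. hausdorff_distance (limit_spectrum m) {0, 1}) \<longlonglongrightarrow> 0"
  proof (rule tendsto_sandwich[OF _ _ tendsto_const upper])
    show "\<forall>\<^sub>F m in sequentially. hausdorff_distance (limit_spectrum m) {0, 1} \<le> ennreal (2 / real (m - 1))"
      using eventually_ge_at_top[of "3 :: nat"]
      by eventually_elim (rule hausdorff_distance_limit_spectrum_le)
  qed simp
qed (simp_all add: weakly_converges_eigenvalue_measure weakly_converges_spectral_limit)

end
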